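(* There exist an absolute constant $c > 0$ and $n_0 \in \mathbb{N}$ such that for all integers $n \ge n_0$ and all $m \in \mathbb{N}$ the following holds. Let $M_0, M_1, \ldots, M_n \in \mathbb{C}^{m\times m}$ be matrices and let $M(\mathbf{x}) := M_0 + \sum_{i=1}^n x_i M_i$, where $\mathbf{x} = (x_1,\ldots,x_n)$ are indeterminates. If $\det(M(\mathbf{x})) = \sum_{i=1}^n x_i^n$ as polynomials in $\mathbb{C}[x_1,\ldots,x_n]$, then $m \ge c\, n^2$.
   Context: The paper's conclusion is "$m = \Omega(n^2)$" for all sufficiently large $n$; this is the statement written out with explicit constants. Equivalently, the determinantal complexity of $\sum_{i=1}^n x_i^n$ over $\mathbb{C}$ is $\Omega(n^2)$, where the determinantal complexity of a polynomial $F \in \mathbb{C}[\mathbf{x}]$ is the smallest $m$ such that $F = \det(M(\mathbf{x}))$ for some $m \times m$ matrix $M(\mathbf{x})$ whose entries are polynomials of degree at most one in $\mathbb{C}[\mathbf{x}]$. *)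

theory Defs
  imports
    Complex_Main
    "HOL-Library.Poly_Mapping"
    "Jordan_Normal_Form.Determinant"
begin

text \<open>
  Polynomials over the complex numbers in indeterminates indexed by the natural numbers: an
  exponent vector is a finitely supported map from indeterminates to exponents, and a polynomial
  is a finitely supported map from exponent vectors to coefficients, with the convolution product
  of \<^theory>\<open>HOL-Library.Poly_Mapping\<close>. The ring in finitely many indeterminates
  $x_1, \ldots, x_n$ is the subring of those polynomials in which no other indeterminate occurs;
  in particular two of its elements are equal iff all their coefficients agree.
\<close>

type_synonym cpoly = "(nat \<Rightarrow>\<^sub>0 nat) \<Rightarrow>\<^sub>0 complex"

definition const_poly :: "complex \<Rightarrow> cpoly" where
  "const_poly c = Poly_Mapping.single 0 c"

definition indet :: "nat \<Rightarrow> cpoly" where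
  "indet i = Poly_Mapping.single (Poly_Mapping.single i 1) 1"

text \<open>
  The matrix $M_0 + \sum_{i=1}^n x_i M_i$. It is written entrywise because matrices of unspecified
  size do not form an additive monoid type, so that \<^const>\<open>sum\<close> is not available for them.
\<close>

definition affine_matrix :: "nat \<Rightarrow> nat \<Rightarrow> (nat \<Rightarrow> complex mat) \<Rightarrow> cpoly mat" where
  "affine_matrix n m M = mat m m (\<lambda>(r, s).
     const_poly (M 0 $$ (r, s)) + (\<Sum>i = 1..n. indet i * const_poly (M i $$ (r, s))))"

end

theory Submission
  imports Defs
begin

text \<open>
  The bound compares two degrees of the gradient map. Dehomogenise by \<open>x\<^sub>n = 1\<close>, so that with
  \<open>k = n - 1\<close> the matrix \<open>A(x)\<close> is affine in \<open>k\<close> variables with determinant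
  \<open>f = 1 + x\<^sub>1\<^sup>n + \<dots> + x\<^sub>k\<^sup>n\<close>. The partial derivatives of \<open>f\<close> are multiples of the \<open>x\<^sub>i\<^sup>k\<close>,
  over which the \<open>x\<^sub>i\<close> generate an extension of degree about \<open>k\<^sup>k\<close>. On the hypersurface \<open>f = 0\<close> the
  adjugate \<open>G\<close> of \<open>A\<close> satisfies \<open>G L\<^sub>i G = \<partial>\<^sub>if G\<close>, so the gradient is the bilinear expression
  \<open>v L\<^sub>i u\<close> in kernel vectors, and a bilinear system in \<open>k + 2m\<close> unknowns only has about
  \<open>(C m / k)\<^sup>k\<close> solutions. Hence \<open>k\<^sup>k \<le> (C m / k)\<^sup>k\<close> up to lower order factors.

  The second degree is bounded by counting instead of Bezout's theorem. With \<open>x, u, v\<close> independent,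
  the products of a monomial in \<open>x\<close> from a box of size \<open>k\<^sup>k\<^sup>-\<^sup>1\<close> with monomials in the forms
  \<open>v L\<^sub>i u\<close>, \<open>A u\<close>, \<open>v A\<close> lie in a space of polynomials of bounded tridegree. If \<open>m\<close> were small
  there would be more products than dimensions, hence a nontrivial linear relation. Substituting
  \<open>u = A\<inverse>p\<close>, \<open>v = qA\<inverse>\<close> and comparing the highest poles along \<open>f = 0\<close> leaves a nontrivial relation
  between distinct monomials in \<open>x\<close>, which is absurd.
\<close>

subsection \<open>Monomials\<close>

definition monom_at :: "nat \<Rightarrow> (nat \<Rightarrow> 'a::comm_monoid_mult) \<Rightarrow> (nat \<Rightarrow> nat) \<Rightarrow> 'a" where
  "monom_at n x e = (\<Prod>i<n. x i ^ e i)"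

definition exponents :: "nat \<Rightarrow> nat \<Rightarrow> (nat \<Rightarrow> nat) set" where
  "exponents n d = {e. (\<forall>i\<ge>n. e i = 0) \<and> sum e {..<n} \<le> d}"

text \<open>The last exponent is written \<open>d - j\<close>, leaving degree at most
  \<open>j\<close> for the other variables. Since \<open>j\<close> can be read off from it, the
  pieces are disjoint and the count becomes a sum over \<open>j\<close>.\<close>

lemma exponents_Suc:
  "exponents (Suc n) d = (\<Union>j\<le>d. (\<lambda>e. e(n := d - j)) ` exponents n j)"
proof (intro Set.set_eqI iffI)
  fix e assume e: "e \<in> exponents (Suc n) d"
  then have le: "sum e {..<n} + e n \<le> d" by (auto simp: exponents_def)
  have "e(n := 0) \<in> exponents n (d - e n)"
    using e le by (auto simp: exponents_def)
  moreover have "e = (e(n := 0))(n := d - (d - e n))" using le by auto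
  ultimately have "e \<in> (\<lambda>e'. e'(n := d - (d - e n))) ` exponents n (d - e n)"
    by (metis (no_types, lifting) image_eqI)
  then show "e \<in> (\<Union>j\<le>d. (\<lambda>e. e(n := d - j)) ` exponents n j)"
    by (intro UN_I[of "d - e n"]) auto
next
  fix e assume "e \<in> (\<Union>j\<le>d. (\<lambda>e. e(n := d - j)) ` exponents n j)"
  then show "e \<in> exponents (Suc n) d" by (auto simp: exponents_def)
qed

lemma card_exponents: "finite (exponents n d) \<and> card (exponents n d) = (d + n) choose n"
proof (induction n arbitrary: d)
  case 0
  have "exponents 0 d = {\<lambda>_. 0}" by (auto simp: exponents_def)
  then show ?case by simp
next
  case (Suc n)
  have inj: "inj_on (\<lambda>e. e(n := d - j)) (exponents n j)" for j
    by (rule inj_onI) (force simp: exponents_def fun_eq_iff split: if_splits)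
  have disj: "(\<lambda>e. e(n := d - i)) ` exponents n i \<inter> (\<lambda>e. e(n := d - j)) ` exponents n j = {}"
    if "i \<le> d" "j \<le> d" "i \<noteq> j" for i j
    using that by (auto simp: fun_eq_iff) (metis diff_diff_cancel)
  have "card (exponents (Suc n) d) = (\<Sum>j\<le>d. card ((\<lambda>e. e(n := d - j)) ` exponents n j))"
    unfolding exponents_Suc using Suc.IH disj by (intro card_UN_disjoint) auto
  also have "\<dots> = (\<Sum>j\<le>d. (n + j) choose n)"
    by (intro sum.cong) (simp_all add: card_image[OF inj] Suc.IH add.commute)
  \<comment> \<open>The hockey-stick identity along a diagonal of Pascal's triangle.\<close>
  also have "\<dots> = (d + Suc n) choose Suc n"
    using choose_rising_sum(1)[of n d] by (simp add: add.commute)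
  finally show ?case using Suc.IH by (simp add: exponents_Suc)
qed

section \<open>Separating monomials by a substitution in one variable\<close>

lemma digits_unique:
  fixes B :: nat
  assumes "\<And>i. i < n \<Longrightarrow> e i < B" "\<And>i. i < n \<Longrightarrow> e' i < B"
    and "(\<Sum>i<n. e i * B ^ i) = (\<Sum>i<n. e' i * B ^ i)" "i < n"
  shows "e i = e' i"
  using assms
proof (induction n arbitrary: e e' i)
  case (Suc n)
  have split: "(\<Sum>i<Suc n. g i * B ^ i) = g 0 + B * (\<Sum>i<n. g (Suc i) * B ^ i)" for g :: "nat \<Rightarrow> nat"
    by (simp add: sum.lessThan_Suc_shift sum_distrib_left ac_simps del: sum.lessThan_Suc)
  have eq: "e 0 + B * (\<Sum>i<n. e (Suc i) * B ^ i) = e' 0 + B * (\<Sum>i<n. e' (Suc i) * B ^ i)"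
    using Suc.prems(3) unfolding split .
  have lt: "e 0 < B" "e' 0 < B" using Suc.prems(1,2) by auto
  have e0: "e 0 = e' 0"
    using arg_cong[OF eq, of "\<lambda>s. s mod B"] lt by simp
  with eq lt have "(\<Sum>i<n. e (Suc i) * B ^ i) = (\<Sum>i<n. e' (Suc i) * B ^ i)" by simp
  then have "e (Suc j) = e' (Suc j)" if "j < n" for j
    using Suc.IH[of "\<lambda>i. e (Suc i)" "\<lambda>i. e' (Suc i)" j] Suc.prems(1,2) that by auto
  then show ?case using e0 Suc.prems(4) by (cases i) auto
qed simp

text \<open>Kronecker substitution \<open>x\<^sub>i = t ^ (B ^ i)\<close> turns a polynomial into a univariate one without
  merging monomials, as soon as \<open>B\<close> exceeds all exponents.\<close>

lemma kronecker_substitution: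
  fixes c :: "'i \<Rightarrow> 'a::comm_ring_1" and ex :: "'i \<Rightarrow> nat \<Rightarrow> nat"
  assumes fin: "finite I" and s0: "s0 \<in> I" "c s0 \<noteq> 0"
    and dist: "\<And>s. s \<in> I \<Longrightarrow> s \<noteq> s0 \<Longrightarrow> \<exists>i<n. ex s i \<noteq> ex s0 i"
  shows "\<exists>B0. \<forall>B\<ge>B0. \<exists>Q. Q \<noteq> 0 \<and>
    (\<forall>t. poly Q t = (\<Sum>s\<in>I. c s * monom_at n (\<lambda>i. t ^ (B ^ i)) (ex s)))"
proof -
  have "finite (\<Union>s\<in>I. ex s ` {..<n})" using fin by auto
  then obtain B0 where B0: "\<And>b. b \<in> (\<Union>s\<in>I. ex s ` {..<n}) \<Longrightarrow> b < B0"
    by (meson bounded_nat_set_is_finite finite_nat_set_iff_bounded)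
  show ?thesis
  proof (intro exI[of _ B0] allI impI)
    fix B assume "B0 \<le> B"
    then have lt: "ex s i < B" if "s \<in> I" "i < n" for s i using B0[of "ex s i"] that by force
    define N where "N s = (\<Sum>i<n. ex s i * B ^ i)" for s
    have inj: "s = s0" if "s \<in> I" "N s = N s0" for s
    proof (rule ccontr)
      assume "s \<noteq> s0"
      then obtain i where "i < n" "ex s i \<noteq> ex s0 i" using dist \<open>s \<in> I\<close> by blast
      then show False
        using digits_unique[of n "ex s" B "ex s0" i] lt that s0 unfolding N_def by blast
    qed
    define Q where "Q = (\<Sum>s\<in>I. monom (c s) (N s))"
    \<comment> \<open>Other indices may collide among themselves, but none shares the exponent
      \<open>N s0\<close>, so this coefficient cannot cancel.\<close>
    have "coeff Q (N s0) = (\<Sum>s\<in>I. if s = s0 then c s else 0)"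
      unfolding Q_def coeff_sum coeff_monom using inj by (intro sum.cong) auto
    also have "\<dots> = c s0" using fin s0 by simp
    finally have "Q \<noteq> 0" using s0 by auto
    moreover have "poly Q t = (\<Sum>s\<in>I. c s * monom_at n (\<lambda>i. t ^ (B ^ i)) (ex s))" for t
      unfolding Q_def poly_sum poly_monom N_def monom_at_def
      by (simp add: power_sum power_mult [symmetric] mult.commute)
    ultimately show "\<exists>Q. Q \<noteq> 0 \<and> (\<forall>t. poly Q t = (\<Sum>s\<in>I. c s * monom_at n (\<lambda>i. t ^ (B ^ i)) (ex s)))"
      by blast
  qed
qed

text \<open>One base \<open>B\<close> serves both polynomials, so both become nonzero in the same
  variable \<open>t\<close>; their product is nonzero and has a nonroot.\<close>

lemma common_nonroot:
  fixes c :: "'i \<Rightarrow> 'a::{idom, ring_char_0}" and d :: "'j \<Rightarrow> 'a"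
  assumes "finite I" "s0 \<in> I" "c s0 \<noteq> 0"
      "\<And>s. s \<in> I \<Longrightarrow> s \<noteq> s0 \<Longrightarrow> \<exists>i<n. ex s i \<noteq> ex s0 i"
    and "finite J" "t0 \<in> J" "d t0 \<noteq> 0"
      "\<And>t. t \<in> J \<Longrightarrow> t \<noteq> t0 \<Longrightarrow> \<exists>i<n. ey t i \<noteq> ey t0 i"
  shows "\<exists>x. (\<Sum>s\<in>I. c s * monom_at n x (ex s)) \<noteq> 0 \<and> (\<Sum>t\<in>J. d t * monom_at n x (ey t)) \<noteq> 0"
proof -
  obtain B1 where B1: "\<And>B. B \<ge> B1 \<Longrightarrow> \<exists>Q. Q \<noteq> 0 \<and>
    (\<forall>t. poly Q t = (\<Sum>s\<in>I. c s * monom_at n (\<lambda>i. t ^ (B ^ i)) (ex s)))"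
    using kronecker_substitution[where c = c and ex = ex, OF assms(1-4)] by blast
  obtain B2 where B2: "\<And>B. B \<ge> B2 \<Longrightarrow> \<exists>Q. Q \<noteq> 0 \<and>
    (\<forall>t. poly Q t = (\<Sum>s\<in>J. d s * monom_at n (\<lambda>i. t ^ (B ^ i)) (ey s)))"
    using kronecker_substitution[where c = d and ex = ey, OF assms(5-8)] by blast
  define B where "B = max B1 B2"
  obtain Q where Q: "Q \<noteq> 0" "\<And>t. poly Q t = (\<Sum>s\<in>I. c s * monom_at n (\<lambda>i. t ^ (B ^ i)) (ex s))"
    using B1[of B] unfolding B_def by auto
  obtain R where R: "R \<noteq> 0" "\<And>t. poly R t = (\<Sum>s\<in>J. d s * monom_at n (\<lambda>i. t ^ (B ^ i)) (ey s))"
    using B2[of B] unfolding B_def by auto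
  have "Q * R \<noteq> 0" using Q R by simp
  then obtain t where "poly (Q * R) t \<noteq> 0"
    using poly_all_0_iff_0 by blast
  then show ?thesis using Q(2) R(2) by (intro exI[of _ "\<lambda>i. t ^ (B ^ i)"]) auto
qed

section \<open>Linear dependence, and rules for monomials\<close>

lemma homogeneous_system_nontrivial:
  fixes A :: "'s \<Rightarrow> 't \<Rightarrow> 'a::field"
  assumes "finite T" "finite S" "card T < card S"
  shows "\<exists>c. (\<exists>s\<in>S. c s \<noteq> 0) \<and> (\<forall>t\<in>T. (\<Sum>s\<in>S. c s * A s t) = 0)"
  using assms
proof (induction T arbitrary: S A rule: finite_induct)
  case empty
  then obtain s where "s \<in> S" by (metis card.empty card_0_eq ex_in_conv less_irrefl)
  then show ?case by (intro exI[of _ "\<lambda>_. 1"]) auto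
next
  case (insert t0 T)
  show ?case
  proof (cases "\<forall>s\<in>S. A s t0 = 0")
    case True
    have "card T < card S" using insert.prems insert.hyps by simp
    from insert.IH[OF insert.prems(1) this, of A] obtain c where
      "\<exists>s\<in>S. c s \<noteq> 0" "\<forall>t\<in>T. (\<Sum>s\<in>S. c s * A s t) = 0" by blast
    moreover have "(\<Sum>s\<in>S. c s * A s t0) = 0" using True by simp
    ultimately show ?thesis by blast
  next
    case False
    then obtain s0 where s0: "s0 \<in> S" "A s0 t0 \<noteq> 0" by blast
    \<comment> \<open>Solving equation \<open>t0\<close> for the unknown \<open>s0\<close> and
      substituting into the others yields the coefficients \<open>A'\<close>; \<open>d\<close> below
      restores the eliminated unknown.\<close>
    define A' where "A' s t = A s t - A s t0 / A s0 t0 * A s0 t" for s t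
    have "card T < card (S - {s0})" using insert.prems insert.hyps s0 by simp
    from insert.IH[OF _ this, of A'] insert.prems(1) obtain c where
      c: "\<exists>s\<in>S - {s0}. c s \<noteq> 0" "\<forall>t\<in>T. (\<Sum>s\<in>S - {s0}. c s * A' s t) = 0" by blast
    define d where "d = c(s0 := - (\<Sum>s\<in>S - {s0}. c s * (A s t0 / A s0 t0)))"
    have eq: "(\<Sum>s\<in>S. d s * A s t) = (\<Sum>s\<in>S - {s0}. c s * A' s t)" for t
    proof -
      have "(\<Sum>s\<in>S. d s * A s t) = d s0 * A s0 t + (\<Sum>s\<in>S - {s0}. d s * A s t)"
        using insert.prems(1) s0 by (rule_tac sum.remove)
      also have "(\<Sum>s\<in>S - {s0}. d s * A s t) = (\<Sum>s\<in>S - {s0}. c s * A s t)"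
        by (intro sum.cong) (auto simp: d_def)
      finally show ?thesis
        by (simp add: d_def A'_def sum_subtractf sum_distrib_left sum_distrib_right algebra_simps)
    qed
    have "A' s t0 = 0" for s using s0 by (simp add: A'_def)
    then have "\<forall>t\<in>insert t0 T. (\<Sum>s\<in>S. d s * A s t) = 0" using c(2) by (auto simp: eq)
    moreover have "\<exists>s\<in>S. d s \<noteq> 0" using c(1) by (auto simp: d_def)
    ultimately show ?thesis by blast
  qed
qed

lemma monom_at_scale: "monom_at n (\<lambda>i. c * x i) e = c ^ sum e {..<n} * monom_at n x e"
  by (simp add: monom_at_def power_mult_distrib prod.distrib power_sum)

lemma monom_at_cong: "(\<And>i. i < n \<Longrightarrow> x i = y i) \<Longrightarrow> monom_at n x e = monom_at n y e"
  by (simp add: monom_at_def)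

lemma isCont_monom_at:
  fixes x :: "real \<Rightarrow> nat \<Rightarrow> complex"
  assumes "\<And>i. i < n \<Longrightarrow> isCont (\<lambda>\<tau>. x \<tau> i) \<tau>0"
  shows "isCont (\<lambda>\<tau>. monom_at n (x \<tau>) e) \<tau>0"
  unfolding monom_at_def using assms by (intro continuous_intros) auto

text \<open>Concatenation merges two groups of variables into one, so that
  \<open>common_nonroot\<close> applies to polynomials in both.\<close>

definition join :: "nat \<Rightarrow> (nat \<Rightarrow> 'a) \<Rightarrow> (nat \<Rightarrow> 'a) \<Rightarrow> nat \<Rightarrow> 'a" where
  "join m e e' i = (if i < m then e i else e' (i - m))"

abbreviation unit_exp :: "nat \<Rightarrow> nat \<Rightarrow> nat" where
  "unit_exp j \<equiv> \<lambda>i. if i = j then 1 else 0"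

lemma monom_at_join:
  "monom_at (m + n) x (join m e e') = monom_at m x e * monom_at n (\<lambda>i. x (m + i)) e'"
proof (induction n)
  case 0
  show ?case by (simp add: monom_at_def join_def)
next
  case (Suc n)
  then show ?case by (simp add: monom_at_def join_def mult.assoc)
qed

lemma monom_at_unit: "j < n \<Longrightarrow> monom_at n x (unit_exp j) = x j"
  unfolding monom_at_def by (subst prod.remove[of _ j]) auto

lemma join_distinct:
  assumes "(e, e') \<noteq> (d, d')" "\<forall>i\<ge>m. e i = 0 \<and> d i = 0" "\<forall>i\<ge>n. e' i = 0 \<and> d' i = 0"
  shows "\<exists>i<m + n. join m e e' i \<noteq> join m d d' i"
proof (rule ccontr)
  assume "\<not> ?thesis"
  then have eq: "join m e e' i = join m d d' i" if "i < m + n" for i using that by blast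
  have "e i = d i" for i
    using eq[of i] assms(2) by (cases "i < m") (auto simp: join_def)
  moreover have "e' i = d' i" for i
    using eq[of "m + i"] assms(3) by (cases "i < n") (auto simp: join_def)
  ultimately show False using assms(1) by auto
qed

lemma complex_nth_root_exists:
  fixes z :: complex
  assumes "n > 0"
  shows "\<exists>w. w ^ n = z"
proof -
  have "rcis (root n (cmod z)) (Arg z / real n) ^ n = rcis (cmod z) (Arg z)"
    using assms by (simp add: DeMoivre2)
  then show ?thesis by (metis rcis_cmod_Arg)
qed

subsection \<open>Functions polynomial in three groups of variables\<close>

type_synonym trifun = "(nat \<Rightarrow> complex) \<Rightarrow> (nat \<Rightarrow> complex) \<Rightarrow> (nat \<Rightarrow> complex) \<Rightarrow> complex"

abbreviation trimonom :: "nat \<Rightarrow> nat \<Rightarrow> (nat \<Rightarrow> nat) \<Rightarrow> (nat \<Rightarrow> nat) \<Rightarrow> (nat \<Rightarrow> nat) \<Rightarrow> trifun" where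
  "trimonom k m d e g \<equiv> \<lambda>x u v. monom_at k x d * monom_at m u e * monom_at m v g"

text \<open>Polynomials are kept as functions built one term at a time, so that closure properties
  follow by induction without comparing coefficients. The bounds \<open>p\<close>, \<open>q\<close>,
  \<open>r\<close> concern the degrees in \<open>x\<close>, \<open>u\<close>,
  \<open>v\<close>.\<close>

inductive tripoly :: "nat \<Rightarrow> nat \<Rightarrow> nat \<Rightarrow> nat \<Rightarrow> nat \<Rightarrow> trifun \<Rightarrow> bool"
  for k m p q r where
  zero: "tripoly k m p q r (\<lambda>x u v. 0)"
| add_monom: "tripoly k m p q r h \<Longrightarrow> d \<in> exponents k p \<Longrightarrow> e \<in> exponents m q \<Longrightarrow> g \<in> exponents m r \<Longrightarrow>
    tripoly k m p q r (\<lambda>x u v. h x u v + c * trimonom k m d e g x u v)"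

text \<open>Collecting like terms gives a coefficient vector on a fixed finite index set, as the
  dimension count requires.\<close>

lemma tripoly_expansion:
  assumes "tripoly k m p q r h"
  shows "\<exists>c. \<forall>x u v. h x u v =
    (\<Sum>(d, e, g)\<in>exponents k p \<times> exponents m q \<times> exponents m r. c (d, e, g) * trimonom k m d e g x u v)"
  using assms
proof induction
  case zero
  show ?case by (intro exI[of _ "\<lambda>_. 0"]) simp
next
  case (add_monom h d e g c)
  let ?T = "exponents k p \<times> exponents m q \<times> exponents m r"
  have fin: "finite ?T" by (simp add: card_exponents)
  have mem: "(d, e, g) \<in> ?T" using add_monom.hyps by simp
  obtain c' where c': "\<And>x u v. h x u v = (\<Sum>(d, e, g)\<in>?T. c' (d, e, g) * trimonom k m d e g x u v)"
    using add_monom.IH by blast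
  have "h x u v + c * trimonom k m d e g x u v =
    (\<Sum>(d', e', g')\<in>?T. (c' (d', e', g') + (if (d', e', g') = (d, e, g) then c else 0)) *
       trimonom k m d' e' g' x u v)" for x u v
  proof -
    have "(\<Sum>(d', e', g')\<in>?T. (c' (d', e', g') + (if (d', e', g') = (d, e, g) then c else 0)) *
       trimonom k m d' e' g' x u v) =
      (\<Sum>t\<in>?T. (case t of (d', e', g') \<Rightarrow> c' (d', e', g') * trimonom k m d' e' g' x u v) +
        (if t = (d, e, g) then c * trimonom k m d e g x u v else 0))"
      by (intro sum.cong) (auto simp: algebra_simps split: if_splits)
    also have "\<dots> = h x u v + c * trimonom k m d e g x u v"
      unfolding sum.distrib c'[symmetric] using fin mem by simp
    finally show ?thesis by simp
  qed
  then show ?case by (intro exI[of _ "\<lambda>t. c' t + (if t = (d, e, g) then c else 0)"]) simp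
qed

lemma tripoly_const: "tripoly k m p q r (\<lambda>x u v. c)"
proof -
  have "(\<lambda>_. 0) \<in> exponents n l" for n l by (simp add: exponents_def)
  from tripoly.add_monom[OF tripoly.zero this this this, of k m p q r c]
  show ?thesis by (simp add: monom_at_def)
qed

lemma tripoly_add:
  assumes "tripoly k m p q r h'" "tripoly k m p q r h"
  shows "tripoly k m p q r (\<lambda>x u v. h x u v + h' x u v)"
  using assms
proof induction
  case (add_monom h' d e g c)
  then show ?case
    using tripoly.add_monom[of k m p q r "\<lambda>x u v. h x u v + h' x u v" d e g c]
    by (simp add: algebra_simps)
qed simp

lemma tripoly_scale:
  assumes "tripoly k m p q r h"
  shows "tripoly k m p q r (\<lambda>x u v. a * h x u v)"
  using assms
proof induction
  case (add_monom h d e g c)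
  then show ?case
    using tripoly.add_monom[of k m p q r "\<lambda>x u v. a * h x u v" d e g "a * c"]
    by (simp add: algebra_simps)
qed (simp add: tripoly.zero)

lemma tripoly_sum:
  assumes "finite I" "\<And>i. i \<in> I \<Longrightarrow> tripoly k m p q r (h i)"
  shows "tripoly k m p q r (\<lambda>x u v. \<Sum>i\<in>I. h i x u v)"
  using assms
  by (induction I rule: finite_induct) (auto intro: tripoly.zero tripoly_add)

lemma tripoly_mono:
  assumes "tripoly k m p q r h" "p \<le> p'" "q \<le> q'" "r \<le> r'"
  shows "tripoly k m p' q' r' h"
  using assms
proof induction
  case (add_monom h d e g c)
  have "exponents n l \<subseteq> exponents n l'" if "l \<le> l'" for n l l'
    using that by (auto simp: exponents_def)
  then show ?case using add_monom by (intro tripoly.add_monom) blast+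
qed (simp add: tripoly.zero)

lemma exponents_incr:
  assumes "d \<in> exponents n l" "i < n"
  shows "d(i := Suc (d i)) \<in> exponents n (Suc l)"
proof -
  have "sum (d(i := Suc (d i))) {..<n} = Suc (sum d {..<n})"
    using assms(2) by (simp add: sum.remove[of "{..<n}" i])
  then show ?thesis using assms by (auto simp: exponents_def)
qed

lemma monom_at_incr:
  assumes "i < n"
  shows "monom_at n x (d(i := Suc (d i))) = x i * monom_at n x d"
proof -
  have "monom_at n x (d(i := Suc (d i))) = x i ^ Suc (d i) * (\<Prod>j\<in>{..<n} - {i}. x j ^ d j)"
    unfolding monom_at_def using assms by (subst prod.remove[of _ i]) (auto intro!: prod.cong)
  also have "\<dots> = x i * (x i ^ d i * (\<Prod>j\<in>{..<n} - {i}. x j ^ d j))" by (simp add: mult.assoc)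
  also have "x i ^ d i * (\<Prod>j\<in>{..<n} - {i}. x j ^ d j) = monom_at n x d"
    unfolding monom_at_def using assms by (subst (2) prod.remove[of _ i]) auto
  finally show ?thesis .
qed

lemma tripoly_mult_x:
  assumes "tripoly k m p q r h" "i < k"
  shows "tripoly k m (Suc p) q r (\<lambda>x u v. x i * h x u v)"
  using assms
proof induction
  case (add_monom h d e g c)
  have "tripoly k m (Suc p) q r (\<lambda>x u v. x i * h x u v + c * trimonom k m (d(i := Suc (d i))) e g x u v)"
    using add_monom by (intro tripoly.add_monom exponents_incr) auto
  then show ?case unfolding monom_at_incr[OF \<open>i < k\<close>] by (simp add: algebra_simps)
qed (simp add: tripoly.zero)

lemma tripoly_mult_u:
  assumes "tripoly k m p q r h" "i < m"
  shows "tripoly k m p (Suc q) r (\<lambda>x u v. u i * h x u v)"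
  using assms
proof induction
  case (add_monom h d e g c)
  have "tripoly k m p (Suc q) r (\<lambda>x u v. u i * h x u v + c * trimonom k m d (e(i := Suc (e i))) g x u v)"
    using add_monom by (intro tripoly.add_monom exponents_incr) auto
  then show ?case unfolding monom_at_incr[OF \<open>i < m\<close>] by (simp add: algebra_simps)
qed (simp add: tripoly.zero)

lemma tripoly_mult_v:
  assumes "tripoly k m p q r h" "i < m"
  shows "tripoly k m p q (Suc r) (\<lambda>x u v. v i * h x u v)"
  using assms
proof induction
  case (add_monom h d e g c)
  have "tripoly k m p q (Suc r) (\<lambda>x u v. v i * h x u v + c * trimonom k m d e (g(i := Suc (g i))) x u v)"
    using add_monom by (intro tripoly.add_monom exponents_incr) auto
  then show ?case unfolding monom_at_incr[OF \<open>i < m\<close>] by (simp add: algebra_simps)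
qed (simp add: tripoly.zero)

lemma tripoly_mult_pow:
  assumes step: "\<And>p q r h. tripoly k m p q r h \<Longrightarrow>
      tripoly k m (p + dp) (q + dq) (r + dr) (\<lambda>x u v. z x u v * h x u v)"
    and "tripoly k m p q r h"
  shows "tripoly k m (p + dp * j) (q + dq * j) (r + dr * j) (\<lambda>x u v. z x u v ^ j * h x u v)"
proof (induction j)
  case (Suc j)
  from step[OF this] show ?case by (simp add: algebra_simps)
qed (use assms(2) in simp)

text \<open>The increments \<open>dp\<close>, \<open>dq\<close>, \<open>dr\<close> are parameters so
  that one statement covers monomials in \<open>x\<close>, \<open>vLu\<close>, \<open>Au\<close> and
  \<open>vA\<close>, which raise the three degrees differently.\<close>

lemma tripoly_mult_monom:
  assumes step: "\<And>i p q r h. i < n \<Longrightarrow> tripoly k m p q r h \<Longrightarrow>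
      tripoly k m (p + dp) (q + dq) (r + dr) (\<lambda>x u v. z x u v i * h x u v)"
    and h: "tripoly k m p q r h" and "e \<in> exponents n l"
  shows "tripoly k m (p + dp * l) (q + dq * l) (r + dr * l) (\<lambda>x u v. monom_at n (z x u v) e * h x u v)"
proof -
  have "tripoly k m (p + dp * sum e {..<N}) (q + dq * sum e {..<N}) (r + dr * sum e {..<N})
      (\<lambda>x u v. monom_at N (z x u v) e * h x u v)" if "N \<le> n" for N
    using that
  proof (induction N)
    case (Suc N)
    have "tripoly k m (p + dp * sum e {..<N} + dp * e N) (q + dq * sum e {..<N} + dq * e N)
      (r + dr * sum e {..<N} + dr * e N) (\<lambda>x u v. z x u v N ^ e N * (monom_at N (z x u v) e * h x u v))"
      using Suc step[of N] by (intro tripoly_mult_pow) auto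
    then show ?case by (simp add: monom_at_def algebra_simps)
  qed (use h in \<open>simp add: monom_at_def\<close>)
  from this[of n] show ?thesis
    by (rule tripoly_mono) (use assms(3) in \<open>auto simp: exponents_def\<close>)
qed

subsection \<open>Evaluation of polynomials and adjugate matrices\<close>

definition monom_value :: "(nat \<Rightarrow> complex) \<Rightarrow> (nat \<Rightarrow>\<^sub>0 nat) \<Rightarrow> complex" where
  "monom_value \<xi> e = (\<Prod>i\<in>Poly_Mapping.keys e. \<xi> i ^ Poly_Mapping.lookup e i)"

definition eval_poly :: "(nat \<Rightarrow> complex) \<Rightarrow> cpoly \<Rightarrow> complex" where
  "eval_poly \<xi> p = (\<Sum>e\<in>Poly_Mapping.keys p. Poly_Mapping.lookup p e * monom_value \<xi> e)"

lemma monom_value_superset: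
  "finite S \<Longrightarrow> Poly_Mapping.keys e \<subseteq> S \<Longrightarrow> monom_value \<xi> e = (\<Prod>i\<in>S. \<xi> i ^ Poly_Mapping.lookup e i)"
  unfolding monom_value_def by (rule prod.mono_neutral_left) (auto simp: in_keys_iff)

lemma eval_poly_superset:
  "finite S \<Longrightarrow> Poly_Mapping.keys p \<subseteq> S \<Longrightarrow>
    eval_poly \<xi> p = (\<Sum>e\<in>S. Poly_Mapping.lookup p e * monom_value \<xi> e)"
  unfolding eval_poly_def by (rule sum.mono_neutral_left) (auto simp: in_keys_iff)

lemma monom_value_add: "monom_value \<xi> (e + e') = monom_value \<xi> e * monom_value \<xi> e'"
proof -
  let ?S = "Poly_Mapping.keys e \<union> Poly_Mapping.keys e'"
  have "monom_value \<xi> (e + e') = (\<Prod>i\<in>?S. \<xi> i ^ Poly_Mapping.lookup (e + e') i)"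
    by (rule monom_value_superset) (auto dest: subsetD[OF Poly_Mapping.keys_add])
  also have "\<dots> = (\<Prod>i\<in>?S. \<xi> i ^ Poly_Mapping.lookup e i) * (\<Prod>i\<in>?S. \<xi> i ^ Poly_Mapping.lookup e' i)"
    by (simp add: lookup_add power_add prod.distrib)
  also have "\<dots> = monom_value \<xi> e * monom_value \<xi> e'"
    by (simp add: monom_value_superset[of ?S])
  finally show ?thesis .
qed

lemma eval_poly_single: "eval_poly \<xi> (Poly_Mapping.single e c) = c * monom_value \<xi> e"
  by (subst eval_poly_superset[of "{e}"]) (auto simp: lookup_single)

lemma eval_poly_add: "eval_poly \<xi> (p + q) = eval_poly \<xi> p + eval_poly \<xi> q"
proof -
  let ?S = "Poly_Mapping.keys p \<union> Poly_Mapping.keys q"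
  have "eval_poly \<xi> (p + q) = (\<Sum>e\<in>?S. Poly_Mapping.lookup (p + q) e * monom_value \<xi> e)"
    by (rule eval_poly_superset) (auto dest: subsetD[OF Poly_Mapping.keys_add])
  also have "\<dots> = (\<Sum>e\<in>?S. Poly_Mapping.lookup p e * monom_value \<xi> e) +
      (\<Sum>e\<in>?S. Poly_Mapping.lookup q e * monom_value \<xi> e)"
    by (simp add: lookup_add algebra_simps sum.distrib)
  also have "\<dots> = eval_poly \<xi> p + eval_poly \<xi> q"
    by (simp add: eval_poly_superset[of ?S])
  finally show ?thesis .
qed

lemma eval_poly_zero: "eval_poly \<xi> 0 = 0"
  by (simp add: eval_poly_def)

lemma eval_poly_sum: "eval_poly \<xi> (\<Sum>i\<in>I. p i) = (\<Sum>i\<in>I. eval_poly \<xi> (p i))"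
  by (induction I rule: infinite_finite_induct) (simp_all add: eval_poly_zero eval_poly_add)

lemma poly_mapping_eq_sum_single:
  fixes p :: "'a \<Rightarrow>\<^sub>0 'b::comm_monoid_add"
  shows "p = (\<Sum>e\<in>Poly_Mapping.keys p. Poly_Mapping.single e (Poly_Mapping.lookup p e))"
  by (rule poly_mapping_eqI) (simp add: lookup_sum lookup_single when_def in_keys_iff)

lemma eval_poly_mult: "eval_poly \<xi> (p * q) = eval_poly \<xi> p * eval_poly \<xi> q"
proof -
  let ?s = "\<lambda>p e. Poly_Mapping.single e (Poly_Mapping.lookup p e) :: cpoly"
  have "p * q = (\<Sum>e\<in>Poly_Mapping.keys p. ?s p e) * (\<Sum>e\<in>Poly_Mapping.keys q. ?s q e)"
    using poly_mapping_eq_sum_single[of p] poly_mapping_eq_sum_single[of q] by simp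
  also have "\<dots> = (\<Sum>e\<in>Poly_Mapping.keys p. \<Sum>e'\<in>Poly_Mapping.keys q. ?s p e * ?s q e')"
    by (rule sum_product)
  finally have "eval_poly \<xi> (p * q) =
    (\<Sum>e\<in>Poly_Mapping.keys p. \<Sum>e'\<in>Poly_Mapping.keys q. eval_poly \<xi> (?s p e * ?s q e'))"
    by (simp only: eval_poly_sum)
  also have "\<dots> = eval_poly \<xi> p * eval_poly \<xi> q"
    unfolding mult_single eval_poly_single monom_value_add
    by (simp add: eval_poly_def sum_product ac_simps)
  finally show ?thesis .
qed

lemma eval_poly_const: "eval_poly \<xi> (const_poly c) = c"
  by (simp add: const_poly_def eval_poly_single monom_value_def)

lemma eval_poly_indet: "eval_poly \<xi> (indet i) = \<xi> i"
  by (simp add: indet_def eval_poly_single monom_value_def)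

lemma comm_ring_hom_eval_poly: "comm_ring_hom (eval_poly \<xi>)"
proof
  show "eval_poly \<xi> 1 = 1" using eval_poly_const[of \<xi> 1] by (simp add: const_poly_def)
qed (simp_all add: eval_poly_zero eval_poly_add eval_poly_mult)

lemma comm_ring_hom_poly: "comm_ring_hom (\<lambda>p. poly p (t :: 'a::comm_ring_1))"
  by unfold_locales auto

section \<open>Adjugates under ring homomorphisms, and a binomial estimate\<close>

lemma (in comm_ring_hom) hom_adj_mat:
  assumes "B \<in> carrier_mat n n"
  shows "adj_mat (map_mat hom B) = map_mat hom (adj_mat B)"
proof (rule eq_matI)
  fix i j assume "i < dim_row (map_mat hom (adj_mat B))" "j < dim_col (map_mat hom (adj_mat B))"
  then have ij: "i < n" "j < n" using assms by (auto simp: adj_mat_def)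
  have "mat_delete (map_mat hom B) j i = map_mat hom (mat_delete B j i)"
    using assms ij by (intro eq_matI) (auto simp: mat_delete_def)
  then have "cofactor (map_mat hom B) j i = hom (cofactor B j i)"
    by (simp add: cofactor_def hom_distribs)
  then show "adj_mat (map_mat hom B) $$ (i, j) = map_mat hom (adj_mat B) $$ (i, j)"
    using assms ij by (simp add: adj_mat_def)
qed (auto simp: adj_mat_def)

lemma adj_mat_sums:
  assumes "B \<in> carrier_mat m m" "r < m" "t < m"
  shows "(\<Sum>s<m. B $$ (r, s) * adj_mat B $$ (s, t)) = (if r = t then Determinant.det B else 0)"
    and "(\<Sum>s<m. adj_mat B $$ (r, s) * B $$ (s, t)) = (if r = t then Determinant.det B else 0)"
proof -
  note adj = adj_mat[OF assms(1)]
  have "(B * adj_mat B) $$ (r, t) = (\<Sum>s<m. B $$ (r, s) * adj_mat B $$ (s, t))"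
    using assms adj(1) by (auto simp: scalar_prod_def lessThan_atLeast0 intro!: sum.cong)
  then show "(\<Sum>s<m. B $$ (r, s) * adj_mat B $$ (s, t)) = (if r = t then Determinant.det B else 0)"
    unfolding adj(2) using assms by (cases "r = t") simp_all
  have "(adj_mat B * B) $$ (r, t) = (\<Sum>s<m. adj_mat B $$ (r, s) * B $$ (s, t))"
    using assms adj(1) by (auto simp: scalar_prod_def lessThan_atLeast0 intro!: sum.cong)
  then show "(\<Sum>s<m. adj_mat B $$ (r, s) * B $$ (s, t)) = (if r = t then Determinant.det B else 0)"
    unfolding adj(3) using assms by (cases "r = t") simp_all
qed

lemma pderiv_sum: "pderiv (\<Sum>i\<in>I. p i) = (\<Sum>i\<in>I. pderiv (p i))"
  by (induction I rule: infinite_finite_induct) (simp_all add: pderiv_add)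

text \<open>Passing from \<open>Y\<close> to \<open>X\<close> replaces each factor
  \<open>Y + j\<close> of the numerator by \<open>X + j\<close>, with \<open>j\<close> from 1 to
  \<open>m\<close>, and every such quotient is at most \<open>X / Y\<close>.\<close>

lemma choose_ratio_bound:
  assumes "0 < Y" "Y \<le> X"
  shows "real ((X + m) choose m) \<le> (real X / real Y) ^ m * real ((Y + m) choose m)"
proof (induction m)
  case (Suc m)
  have rec: "real ((Z + Suc m) choose Suc m) = real (Z + Suc m) / real (Suc m) * real ((Z + m) choose m)" for Z
  proof -
    have "real (Suc m) * real (Suc (Z + m) choose Suc m) = real (Suc (Z + m)) * real ((Z + m) choose m)"
      by (metis Suc_times_binomial of_nat_mult)
    then show ?thesis by (simp add: field_simps)
  qed
  define \<rho> where "\<rho> = real X / real Y"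
  have "real Y * (1 + real m) \<le> real X * (1 + real m)"
    using assms by (intro mult_right_mono) auto
  then have "real (X + Suc m) \<le> \<rho> * real (Y + Suc m)"
    using assms by (simp add: \<rho>_def field_simps)
  then have "real (X + Suc m) / real (Suc m) * real ((X + m) choose m) \<le>
    \<rho> * real (Y + Suc m) / real (Suc m) * (\<rho> ^ m * real ((Y + m) choose m))"
    using Suc.IH by (intro mult_mono divide_right_mono) (auto simp: \<rho>_def)
  also have "\<dots> = \<rho> ^ Suc m * (real (Y + Suc m) / real (Suc m) * real ((Y + m) choose m))"
    by simp
  finally show ?case unfolding rec \<rho>_def .
qed simp

subsection \<open>Affine determinantal representations of a Fermat polynomial\<close>

text \<open>Here \<open>k\<close> is one less than the original number of variables, so
  \<open>Suc k\<close> is the original degree. The identity is stated between values, so that no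
  multivariate polynomial ring appears inside the locale.\<close>

locale fermat_determinant =
  fixes k m :: nat
    and L0 :: "nat \<Rightarrow> nat \<Rightarrow> complex"
    and L :: "nat \<Rightarrow> nat \<Rightarrow> nat \<Rightarrow> complex"
  assumes k_pos: "k > 0"
    and det: "\<And>x. Determinant.det (mat m m (\<lambda>(r, s). L0 r s + (\<Sum>i<k. x i * L i r s))) =
      1 + (\<Sum>i<k. x i ^ Suc k)"
begin

definition A :: "(nat \<Rightarrow> complex) \<Rightarrow> nat \<Rightarrow> nat \<Rightarrow> complex" where
  "A x r s = L0 r s + (\<Sum>i<k. x i * L i r s)"

definition f :: "(nat \<Rightarrow> complex) \<Rightarrow> complex" where
  "f x = 1 + (\<Sum>i<k. x i ^ Suc k)"

definition Amat :: "(nat \<Rightarrow> complex) \<Rightarrow> complex mat" where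
  "Amat x = mat m m (\<lambda>(r, s). A x r s)"

text \<open>Unlike the inverse, the adjugate exists on \<open>f = 0\<close> too, where its columns
  and rows are right and left kernel vectors of \<open>A\<close>.\<close>

definition G :: "(nat \<Rightarrow> complex) \<Rightarrow> nat \<Rightarrow> nat \<Rightarrow> complex" where
  "G x r s = adj_mat (Amat x) $$ (r, s)"

lemma det_Amat: "Determinant.det (Amat x) = f x"
  unfolding Amat_def A_def f_def by (rule det)

lemma Amat_carrier: "Amat x \<in> carrier_mat m m"
  by (simp add: Amat_def)

lemma Amat_index: "r < m \<Longrightarrow> s < m \<Longrightarrow> Amat x $$ (r, s) = A x r s"
  by (simp add: Amat_def)

lemma
  assumes "r < m" "t < m"
  shows A_G: "(\<Sum>s<m. A x r s * G x s t) = (if r = t then f x else 0)"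
    and G_A: "(\<Sum>s<m. G x r s * A x s t) = (if r = t then f x else 0)"
  using adj_mat_sums[OF Amat_carrier assms, of x] assms
  by (simp_all add: det_Amat G_def Amat_index)

text \<open>Along a line the matrix has entries of degree at most one in \<open>t\<close>, and its
  adjugate can be formed over univariate polynomials. The product identity then holds between
  polynomials and may be differentiated.\<close>

lemma restriction_to_line:
  obtains P F where
    "\<And>t r s. r < m \<Longrightarrow> s < m \<Longrightarrow> G (\<lambda>i. x i + t * d i) r s = poly (P r s) t"
    "\<And>t. poly F t = f (\<lambda>i. x i + t * d i)"
    "\<And>r w. r < m \<Longrightarrow> w < m \<Longrightarrow>
      (\<Sum>s<m. [:A x r s, \<Sum>i<k. d i * L i r s:] * P s w) = (if r = w then F else 0)"
proof -
  define B where "B = mat m m (\<lambda>(r, s). [:A x r s, \<Sum>i<k. d i * L i r s:])"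
  have B: "B \<in> carrier_mat m m" by (simp add: B_def)
  have B_index: "B $$ (r, s) = [:A x r s, \<Sum>i<k. d i * L i r s:]" if "r < m" "s < m" for r s
    using that by (simp add: B_def)
  have eval: "map_mat (\<lambda>p. poly p t) B = Amat (\<lambda>i. x i + t * d i)" for t
    by (rule eq_matI) (auto simp: B_def Amat_def A_def sum.distrib sum_distrib_left algebra_simps)
  show ?thesis
  proof
    show "G (\<lambda>i. x i + t * d i) r s = poly (adj_mat B $$ (r, s)) t" if "r < m" "s < m" for t r s
      using that adj_mat(1)[OF B] comm_ring_hom.hom_adj_mat[OF comm_ring_hom_poly B, of t]
      by (simp add: G_def eval)
    show "poly (Determinant.det B) t = f (\<lambda>i. x i + t * d i)" for t
      using comm_ring_hom.hom_det[OF comm_ring_hom_poly, of t B] by (simp add: eval det_Amat)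
    show "(\<Sum>s<m. [:A x r s, \<Sum>i<k. d i * L i r s:] * adj_mat B $$ (s, w)) =
      (if r = w then Determinant.det B else 0)" if "r < m" "w < m" for r w
      unfolding adj_mat_sums(1)[OF B that, symmetric]
      using that by (intro sum.cong) (simp_all only: B_index lessThan_iff)
  qed
qed

lemma G_cont:
  assumes "r < m" "s < m"
  shows "isCont (\<lambda>\<tau>::real. G (\<lambda>i. of_real \<tau> * x i) r s) \<tau>0"
proof -
  obtain P F where P: "\<And>t r s. r < m \<Longrightarrow> s < m \<Longrightarrow> G (\<lambda>i. 0 + t * x i) r s = poly (P r s) t"
    and "\<And>t. poly F t = f (\<lambda>i. 0 + t * x i)"
    and "\<And>r w. r < m \<Longrightarrow> w < m \<Longrightarrow>
      (\<Sum>s<m. [:A (\<lambda>_. 0) r s, \<Sum>i<k. x i * L i r s:] * P s w) = (if r = w then F else 0)"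
    using restriction_to_line[of "\<lambda>_. 0" x] by blast
  have "isCont complex_of_real \<tau>0"
    by (rule continuous_of_real[OF continuous_ident])
  then have "isCont (\<lambda>\<tau>::real. poly (P r s) (of_real \<tau>)) \<tau>0"
    by (rule isCont_o2[OF _ poly_isCont])
  then show ?thesis using P[OF assms] by simp
qed

text \<open>The product rule applied to \<open>A G = f I\<close> in direction \<open>i\<close>; the
  witness \<open>G'\<close> is the derivative of \<open>G\<close>.\<close>

lemma adjugate_derivative:
  assumes i: "i < k"
  obtains G' where "\<And>r w. r < m \<Longrightarrow> w < m \<Longrightarrow>
    (\<Sum>s<m. L i r s * G x s w) + (\<Sum>s<m. A x r s * G' s w) =
      (if r = w then of_nat (Suc k) * x i ^ k else 0)"
proof -
  let ?d = "\<lambda>j. if j = i then 1 else 0 :: complex"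
  obtain P F where
    P: "\<And>t r s. r < m \<Longrightarrow> s < m \<Longrightarrow> G (\<lambda>j. x j + t * ?d j) r s = poly (P r s) t"
    and F: "\<And>t. poly F t = f (\<lambda>j. x j + t * ?d j)"
    and PF: "\<And>r w. r < m \<Longrightarrow> w < m \<Longrightarrow>
      (\<Sum>s<m. [:A x r s, \<Sum>j<k. ?d j * L j r s:] * P s w) = (if r = w then F else 0)"
    using restriction_to_line[of x ?d] by blast
  have P0: "poly (P r s) 0 = G x r s" if "r < m" "s < m" for r s
    using P[OF that, of 0] by simp
  have "F = [:1 + (\<Sum>j\<in>{..<k} - {i}. x j ^ Suc k):] + [:x i, 1:] ^ Suc k"
  proof (rule poly_ext)
    fix t
    have "f (\<lambda>j. x j + t * ?d j) = 1 + (\<Sum>j\<in>{..<k} - {i}. (x j + t * ?d j) ^ Suc k) + (x i + t) ^ Suc k"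
      unfolding f_def using i by (subst sum.remove[of _ i]) (auto simp del: power_Suc)
    also have "(\<Sum>j\<in>{..<k} - {i}. (x j + t * ?d j) ^ Suc k) = (\<Sum>j\<in>{..<k} - {i}. x j ^ Suc k)"
      by (intro sum.cong) auto
    finally show "poly F t = poly ([:1 + (\<Sum>j\<in>{..<k} - {i}. x j ^ Suc k):] + [:x i, 1:] ^ Suc k) t"
      unfolding F by (simp add: poly_power del: power_Suc)
  qed
  then have F': "poly (pderiv F) 0 = of_nat (Suc k) * x i ^ k"
    by (simp add: pderiv_add pderiv_power_Suc pderiv_pCons poly_power del: power_Suc)
  show ?thesis
  proof
    fix r w assume rw: "r < m" "w < m"
    have "poly (pderiv (\<Sum>s<m. [:A x r s, \<Sum>j<k. ?d j * L j r s:] * P s w)) 0 =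
      (\<Sum>s<m. L i r s * G x s w) + (\<Sum>s<m. A x r s * poly (pderiv (P s w)) 0)"
      using i rw by (simp add: pderiv_sum pderiv_add pderiv_smult poly_sum pderiv_mult pderiv_pCons P0 sum.distrib
          if_distrib[of "\<lambda>c. c * _"] cong: if_cong)
    then show "(\<Sum>s<m. L i r s * G x s w) + (\<Sum>s<m. A x r s * poly (pderiv (P s w)) 0) =
      (if r = w then of_nat (Suc k) * x i ^ k else 0)"
      unfolding PF[OF rw] using F' by (cases "r = w") simp_all
  qed
qed

text \<open>Multiply the derivative identity by \<open>G\<close> from the left: since
  \<open>G A = f I = 0\<close>, the term with the unknown \<open>G'\<close> disappears.\<close>

lemma G_tangent:
  assumes fx: "f x = 0" and i: "i < k" and rw: "r < m" "w < m"
  shows "(\<Sum>s<m. \<Sum>t<m. G x r s * L i s t * G x t w) = of_nat (Suc k) * x i ^ k * G x r w"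
proof -
  obtain G' where G': "\<And>r w. r < m \<Longrightarrow> w < m \<Longrightarrow>
    (\<Sum>s<m. L i r s * G x s w) + (\<Sum>s<m. A x r s * G' s w) =
      (if r = w then of_nat (Suc k) * x i ^ k else 0)"
    using adjugate_derivative[OF i] by blast
  have "(\<Sum>s<m. G x r s * ((\<Sum>t<m. L i s t * G x t w) + (\<Sum>t<m. A x s t * G' t w))) =
    (\<Sum>s<m. if s = w then G x r s * (of_nat (Suc k) * x i ^ k) else 0)"
    using rw by (intro sum.cong) (auto simp: G')
  moreover have "(\<Sum>s<m. G x r s * (\<Sum>t<m. A x s t * G' t w)) =
      (\<Sum>t<m. (\<Sum>s<m. G x r s * A x s t) * G' t w)"
    unfolding sum_distrib_left sum_distrib_right by (subst sum.swap) (simp add: mult.assoc)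
  moreover have "\<dots> = 0" using rw fx by (intro sum.neutral) (auto simp: G_A)
  ultimately have "(\<Sum>s<m. G x r s * (\<Sum>t<m. L i s t * G x t w)) = G x r w * (of_nat (Suc k) * x i ^ k)"
    using rw by (simp add: distrib_left sum.distrib)
  then show ?thesis by (simp add: sum_distrib_left mult.assoc mult.commute[of "G x r w"])
qed

text \<open>The hypersurface is smooth, so some partial derivative is nonzero at \<open>x\<close>.
  If \<open>G\<close> vanished there, the derivative identity would make \<open>A\<close> times
  \<open>G'\<close> a nonzero multiple of the identity, although \<open>A\<close> has determinant
  \<open>f x = 0\<close>.\<close>

lemma G_nonzero:
  assumes fx: "f x = 0"
  shows "\<exists>r<m. \<exists>w<m. G x r w \<noteq> 0"
proof (rule ccontr)
  assume "\<not> ?thesis"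
  then have G0: "G x r w = 0" if "r < m" "w < m" for r w using that by blast
  have "\<exists>i<k. x i \<noteq> 0" using fx unfolding f_def by (rule_tac ccontr) simp
  then obtain i where i: "i < k" "x i \<noteq> 0" by blast
  obtain G' where G': "\<And>r w. r < m \<Longrightarrow> w < m \<Longrightarrow>
    (\<Sum>s<m. L i r s * G x s w) + (\<Sum>s<m. A x r s * G' s w) =
      (if r = w then of_nat (Suc k) * x i ^ k else 0)"
    using adjugate_derivative[OF i(1)] by blast
  let ?D = "mat m m (\<lambda>(s, w). G' s w)"
  have "Amat x * ?D = (of_nat (Suc k) * x i ^ k) \<cdot>\<^sub>m 1\<^sub>m m"
  proof (rule eq_matI)
    fix r w assume "r < dim_row ((of_nat (Suc k) * x i ^ k) \<cdot>\<^sub>m 1\<^sub>m m :: complex mat)"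
      "w < dim_col ((of_nat (Suc k) * x i ^ k) \<cdot>\<^sub>m 1\<^sub>m m :: complex mat)"
    then have rw: "r < m" "w < m" by auto
    have "(Amat x * ?D) $$ (r, w) = (\<Sum>s<m. A x r s * G' s w)"
      using rw by (auto simp: Amat_def scalar_prod_def lessThan_atLeast0 intro!: sum.cong)
    also have "\<dots> = (if r = w then of_nat (Suc k) * x i ^ k else 0)"
      using G'[OF rw] rw by (simp add: G0)
    finally show "(Amat x * ?D) $$ (r, w) = ((of_nat (Suc k) * x i ^ k) \<cdot>\<^sub>m 1\<^sub>m m) $$ (r, w)"
      using rw by simp
  qed (simp_all add: Amat_def)
  then have "Determinant.det (Amat x * ?D) = (of_nat (Suc k) * x i ^ k) ^ m" by simp
  moreover have "Determinant.det (Amat x * ?D) = Determinant.det (Amat x) * Determinant.det ?D"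
    by (rule det_mult[OF Amat_carrier]) simp
  ultimately have "(of_nat (Suc k) * x i ^ k) ^ m = (0 :: complex)" using fx by (simp add: det_Amat)
  then show False using i fx by (simp add: det_Amat del: of_nat_Suc)
qed

subsection \<open>A linear relation among products of bilinear forms\<close>

definition vLu :: "(nat \<Rightarrow> complex) \<Rightarrow> (nat \<Rightarrow> complex) \<Rightarrow> nat \<Rightarrow> complex" where
  "vLu u v i = (\<Sum>s<m. \<Sum>t<m. L i s t * (v s * u t))"

definition Au where "Au x u r = (\<Sum>s<m. A x r s * u s)"

definition vA where "vA x v s = (\<Sum>r<m. A x r s * v r)"

text \<open>The last exponent of \<open>pad g\<close> makes the total degree \<open>(k - 1)\<^sup>2\<close> for every box vector \<open>g\<close>, so
  that vanishing on the affine hypersurface \<open>f = 0\<close> extends to its cone, which is dense.\<close>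

definition pad :: "(nat \<Rightarrow> nat) \<Rightarrow> nat \<Rightarrow> nat" where
  "pad g i = (if i < k - 1 then g i else if i = k - 1 then (k - 1) * (k - 1) - (\<Sum>j<k - 1. g j) else 0)"

definition family :: "(nat \<Rightarrow> nat) \<times> (nat \<Rightarrow> nat) \<times> (nat \<Rightarrow> nat) \<times> (nat \<Rightarrow> nat) \<Rightarrow> trifun" where
  "family = (\<lambda>(g, \<beta>, \<gamma>, \<delta>) x u v. monom_at k x (pad g) * (monom_at k (vLu u v) \<beta> *
     (monom_at m (Au x u) \<gamma> * monom_at m (vA x v) \<delta>)))"

text \<open>Entries below \<open>k\<close> act as remainders modulo \<open>k\<close>, so a box
  monomial times a monomial in the \<open>x i ^ k\<close> determines both factors. Coordinate
  \<open>k - 1\<close> is left to \<open>pad\<close>.\<close>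

definition boxes :: "(nat \<Rightarrow> nat) set" where "boxes = (\<Pi>\<^sub>E i\<in>{..<k - 1}. {..<k})"

definition index :: "nat \<Rightarrow> nat \<Rightarrow> ((nat \<Rightarrow> nat) \<times> (nat \<Rightarrow> nat) \<times> (nat \<Rightarrow> nat) \<times> (nat \<Rightarrow> nat)) set" where
  "index K P = boxes \<times> exponents k K \<times> exponents m P \<times> exponents m P"

lemma sum_pad:
  assumes "g \<in> boxes"
  shows "sum (pad g) {..<k} = (k - 1) * (k - 1)"
proof -
  obtain k' where k': "k = Suc k'" using k_pos by (cases k) auto
  have "g j < k" if "j < k - 1" for j
    using assms that unfolding boxes_def by (auto dest!: PiE_mem)
  \<comment> \<open>This bound keeps the natural subtraction in \<open>pad\<close> from
    truncating.\<close>
  then have "(\<Sum>j<k'. g j) \<le> (\<Sum>j<k'. k')"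
    by (intro sum_mono) (auto simp: k' less_Suc_eq_le)
  then have "(\<Sum>j<k'. g j) \<le> k' * k'" by simp
  moreover have "pad g i = (if i < k' then g i else k' * k' - (\<Sum>j<k'. g j))" if "i < k" for i
    using that unfolding pad_def by (simp add: k')
  then have "sum (pad g) {..<k} = (\<Sum>j<k'. g j) + (k' * k' - (\<Sum>j<k'. g j))"
    by (simp add: k')
  ultimately show ?thesis using k' by simp
qed

lemma pad_exponents: "g \<in> boxes \<Longrightarrow> pad g \<in> exponents k ((k - 1) * (k - 1))"
  using sum_pad[of g] k_pos by (auto simp: exponents_def pad_def)

lemma card_index:
  "finite (index K P)"
  "card (index K P) = k ^ (k - 1) * (((K + k) choose k) * (((P + m) choose m) * ((P + m) choose m)))"
  unfolding index_def boxes_def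
  by (simp_all add: card_exponents card_cartesian_product card_PiE finite_PiE)

lemma tripoly_A:
  assumes "tripoly k m p q r h"
  shows "tripoly k m (Suc p) q r (\<lambda>x u v. A x i j * h x u v)"
proof -
  have "tripoly k m (Suc p) q r (\<lambda>x u v. (\<Sum>l<k. L l i j * (x l * h x u v)) + L0 i j * h x u v)"
    by (intro tripoly_add tripoly_scale tripoly_sum tripoly_mult_x assms tripoly_mono[OF assms]) auto
  then show ?thesis unfolding A_def by (simp add: algebra_simps sum_distrib_left sum_distrib_right)
qed

lemma tripoly_mult_vLu:
  assumes "tripoly k m p q r h"
  shows "tripoly k m (p + 0) (q + 1) (r + 1) (\<lambda>x u v. vLu u v i * h x u v)"
proof -
  have "tripoly k m p (Suc q) (Suc r) (\<lambda>x u v. \<Sum>s<m. \<Sum>t<m. L i s t * (v s * (u t * h x u v)))"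
    using assms by (intro tripoly_sum tripoly_scale tripoly_mult_u tripoly_mult_v) auto
  then show ?thesis unfolding vLu_def by (simp add: sum_distrib_right mult.assoc)
qed

lemma tripoly_mult_Au:
  assumes "tripoly k m p q r h"
  shows "tripoly k m (p + 1) (q + 1) (r + 0) (\<lambda>x u v. Au x u i * h x u v)"
proof -
  have "tripoly k m (Suc p) (Suc q) r (\<lambda>x u v. \<Sum>s<m. A x i s * (u s * h x u v))"
    using assms by (intro tripoly_sum tripoly_A tripoly_mult_u) auto
  then show ?thesis unfolding Au_def by (simp add: sum_distrib_right mult.assoc)
qed

lemma tripoly_mult_vA:
  assumes "tripoly k m p q r h"
  shows "tripoly k m (p + 1) (q + 0) (r + 1) (\<lambda>x u v. vA x v i * h x u v)"
proof -
  have "tripoly k m (Suc p) q (Suc r) (\<lambda>x u v. \<Sum>s<m. A x s i * (v s * h x u v))"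
    using assms by (intro tripoly_sum tripoly_A tripoly_mult_v) auto
  then show ?thesis unfolding vA_def by (simp add: sum_distrib_right mult.assoc)
qed

lemma tripoly_family:
  assumes "t \<in> index K P"
  shows "tripoly k m ((k - 1) * (k - 1) + 2 * P) (K + P) (K + P) (family t)"
proof -
  obtain g \<beta> \<gamma> \<delta> where t: "t = (g, \<beta>, \<gamma>, \<delta>)" "g \<in> boxes" "\<beta> \<in> exponents k K"
    "\<gamma> \<in> exponents m P" "\<delta> \<in> exponents m P"
    using assms by (auto simp: index_def)
  have "tripoly k m (0 + 1 * P) (0 + 0 * P) (0 + 1 * P) (\<lambda>x u v. monom_at m (vA x v) \<delta> * 1)"
    by (intro tripoly_mult_monom tripoly_mult_vA tripoly_const t)
  then have "tripoly k m (P + 1 * P) (0 + 1 * P) (P + 0 * P)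
      (\<lambda>x u v. monom_at m (Au x u) \<gamma> * monom_at m (vA x v) \<delta>)"
    by (intro tripoly_mult_monom tripoly_mult_Au t) simp_all
  then have "tripoly k m (P + P + 0 * K) (P + 1 * K) (P + 1 * K)
      (\<lambda>x u v. monom_at k (vLu u v) \<beta> * (monom_at m (Au x u) \<gamma> * monom_at m (vA x v) \<delta>))"
    by (intro tripoly_mult_monom tripoly_mult_vLu t) simp_all
  then have "tripoly k m (P + P + 1 * ((k - 1) * (k - 1))) (P + K + 0 * ((k - 1) * (k - 1)))
      (P + K + 0 * ((k - 1) * (k - 1))) (\<lambda>x u v. monom_at k x (pad g) *
      (monom_at k (vLu u v) \<beta> * (monom_at m (Au x u) \<gamma> * monom_at m (vA x v) \<delta>)))"
    by (intro tripoly_mult_monom pad_exponents t) (simp_all add: tripoly_mult_x)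
  then show ?thesis unfolding t(1) family_def prod.case by (rule tripoly_mono) simp_all
qed

text \<open>The left side of the assumption counts the monomials available for expansion, the right
  side the members of the family; fewer monomials than members force a relation.\<close>

lemma family_dependent:
  assumes "(((k - 1) * (k - 1) + 2 * P + k) choose k) * (((K + P + m) choose m) * ((K + P + m) choose m))
    < k ^ (k - 1) * (((K + k) choose k) * (((P + m) choose m) * ((P + m) choose m)))"
  shows "\<exists>c. (\<exists>t\<in>index K P. c t \<noteq> 0) \<and> (\<forall>x u v. (\<Sum>t\<in>index K P. c t * family t x u v) = 0)"
proof -
  define T where "T = exponents k ((k - 1) * (k - 1) + 2 * P) \<times> exponents m (K + P) \<times> exponents m (K + P)"
  have finT: "finite T" unfolding T_def by (simp add: card_exponents)
  have "card T = (((k - 1) * (k - 1) + 2 * P + k) choose k) * (((K + P + m) choose m) * ((K + P + m) choose m))"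
    unfolding T_def by (simp add: card_cartesian_product card_exponents)
  then have card: "card T < card (index K P)" using assms by (simp add: card_index)
  have "\<forall>t\<in>index K P. \<exists>w. \<forall>x u v. family t x u v =
      (\<Sum>(d, e, g)\<in>T. w (d, e, g) * trimonom k m d e g x u v)"
    using tripoly_expansion[OF tripoly_family] unfolding T_def by blast
  from bchoice[OF this] obtain w where w: "\<And>t x u v. t \<in> index K P \<Longrightarrow> family t x u v =
      (\<Sum>(d, e, g)\<in>T. w t (d, e, g) * trimonom k m d e g x u v)"
    by blast
  obtain c where c: "\<exists>t\<in>index K P. c t \<noteq> 0" "\<And>\<tau>. \<tau> \<in> T \<Longrightarrow> (\<Sum>t\<in>index K P. c t * w t \<tau>) = 0"
    using homogeneous_system_nontrivial[OF finT card_index(1) card, of w] by blast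
  have "(\<Sum>t\<in>index K P. c t * family t x u v) = 0" for x u v
  proof -
    have "(\<Sum>t\<in>index K P. c t * family t x u v) =
      (\<Sum>t\<in>index K P. \<Sum>\<tau>\<in>T. c t * w t \<tau> * (case \<tau> of (d, e, g) \<Rightarrow> trimonom k m d e g x u v))"
      by (intro sum.cong refl) (simp add: w sum_distrib_left case_prod_unfold mult.assoc)
    also have "\<dots> = (\<Sum>\<tau>\<in>T. (\<Sum>t\<in>index K P. c t * w t \<tau>) * (case \<tau> of (d, e, g) \<Rightarrow> trimonom k m d e g x u v))"
      by (subst sum.swap) (simp add: sum_distrib_right)
    also have "\<dots> = 0" using c(2) by simp
    finally show ?thesis .
  qed
  with c(1) show ?thesis by blast
qed

subsection \<open>Polar part of the relation along the Fermat hypersurface\<close>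

definition pairing :: "(nat \<Rightarrow> complex) \<Rightarrow> (nat \<Rightarrow> complex) \<Rightarrow> (nat \<Rightarrow> complex) \<Rightarrow> complex" where
  "pairing x p q = (\<Sum>r<m. \<Sum>w<m. G x r w * (q r * p w))"

text \<open>The numerators of the forms \<open>vLu\<close> at \<open>u = G p / f\<close> and
  \<open>v = q G / f\<close>.\<close>

definition vLu_G :: "(nat \<Rightarrow> complex) \<Rightarrow> (nat \<Rightarrow> complex) \<Rightarrow> (nat \<Rightarrow> complex) \<Rightarrow> nat \<Rightarrow> complex" where
  "vLu_G x p q = vLu (\<lambda>t. \<Sum>w<m. G x t w * p w) (\<lambda>s. \<Sum>r<m. q r * G x r s)"

text \<open>This is \<open>G_tangent\<close> between the row vector \<open>q\<close> and the column
  vector \<open>p\<close>; the sums over \<open>s\<close> and \<open>t\<close> are moved inside to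
  apply it.\<close>

lemma vLu_G_on_hypersurface:
  assumes "f x = 0" "i < k"
  shows "vLu_G x p q i = (of_nat (Suc k) * pairing x p q) * x i ^ k"
proof -
  have "vLu_G x p q i = (\<Sum>s<m. \<Sum>t<m. \<Sum>r<m. \<Sum>w<m. (G x r s * L i s t * G x t w) * (q r * p w))"
    unfolding vLu_G_def vLu_def by (simp add: sum_product sum_distrib_left ac_simps)
  also have "\<dots> = (\<Sum>s<m. \<Sum>r<m. \<Sum>w<m. \<Sum>t<m. (G x r s * L i s t * G x t w) * (q r * p w))"
    by (subst sum.swap[of _ "{..<m}" "{..<m}"], subst (2) sum.swap) (rule refl)
  also have "\<dots> = (\<Sum>r<m. \<Sum>w<m. \<Sum>s<m. \<Sum>t<m. (G x r s * L i s t * G x t w) * (q r * p w))"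
    by (subst sum.swap, subst (2) sum.swap) (rule refl)
  also have "\<dots> = (\<Sum>r<m. \<Sum>w<m. (\<Sum>s<m. \<Sum>t<m. G x r s * L i s t * G x t w) * (q r * p w))"
    by (simp add: sum_distrib_right)
  also have "\<dots> = (\<Sum>r<m. \<Sum>w<m. of_nat (Suc k) * x i ^ k * G x r w * (q r * p w))"
    using assms by (intro sum.cong refl) (simp only: G_tangent lessThan_iff)
  also have "\<dots> = (of_nat (Suc k) * pairing x p q) * x i ^ k"
    unfolding pairing_def by (simp add: sum_distrib_left ac_simps)
  finally show ?thesis .
qed

lemma Au_resolvent:
  assumes "f x \<noteq> 0" "r < m"
  shows "Au x (\<lambda>t. (\<Sum>w<m. G x t w * p w) / f x) r = p r"
proof -
  have "Au x (\<lambda>t. (\<Sum>w<m. G x t w * p w) / f x) r = (\<Sum>s<m. \<Sum>w<m. A x r s * G x s w * p w / f x)"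
    unfolding Au_def by (simp add: sum_distrib_left sum_divide_distrib mult.assoc)
  also have "\<dots> = (\<Sum>w<m. \<Sum>s<m. A x r s * G x s w * p w / f x)" by (rule sum.swap)
  also have "\<dots> = (\<Sum>w<m. (\<Sum>s<m. A x r s * G x s w) * p w / f x)"
    by (simp add: sum_distrib_right sum_divide_distrib)
  also have "\<dots> = (\<Sum>w<m. if r = w then p w else 0)"
    using assms by (intro sum.cong refl) (simp add: A_G)
  also have "\<dots> = p r" using assms by simp
  finally show ?thesis .
qed

lemma vA_resolvent:
  assumes "f x \<noteq> 0" "s < m"
  shows "vA x (\<lambda>t. (\<Sum>r<m. q r * G x r t) / f x) s = q s"
proof -
  have "vA x (\<lambda>t. (\<Sum>r<m. q r * G x r t) / f x) s = (\<Sum>t<m. \<Sum>r<m. q r * (G x r t * A x t s) / f x)"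
    unfolding vA_def by (simp add: sum_distrib_left sum_divide_distrib ac_simps)
  also have "\<dots> = (\<Sum>r<m. \<Sum>t<m. q r * (G x r t * A x t s) / f x)" by (rule sum.swap)
  also have "\<dots> = (\<Sum>r<m. q r * (\<Sum>t<m. G x r t * A x t s) / f x)"
    by (simp add: sum_distrib_left sum_divide_distrib)
  also have "\<dots> = (\<Sum>r<m. if r = s then q r else 0)"
    using assms by (intro sum.cong refl) (simp add: G_A)
  also have "\<dots> = q s" using assms by simp
  finally show ?thesis .
qed

lemma vLu_scale: "vLu (\<lambda>t. u t / c) (\<lambda>s. v s / c) i = (1 / c\<^sup>2) * vLu u v i"
  unfolding vLu_def by (simp add: sum_distrib_left power2_eq_square)

text \<open>For \<open>u = G p / f\<close> and \<open>v = q G / f\<close> the forms \<open>Au = p\<close> and \<open>vA = q\<close> are constant, whereas the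
  \<open>vLu\<close> have a double pole along \<open>f = 0\<close> with polar part proportional to the gradient of \<open>f\<close>.
  Only the terms of maximal degree in \<open>vLu\<close> survive multiplication by \<open>f ^ (2 * N)\<close>.\<close>

lemma leading_pole:
  assumes rel: "\<And>x u v. (\<Sum>t\<in>I. c t * family t x u v) = 0" and fin: "finite I"
    and N: "\<And>g \<beta> \<gamma> \<delta>. (g, \<beta>, \<gamma>, \<delta>) \<in> I \<Longrightarrow> c (g, \<beta>, \<gamma>, \<delta>) \<noteq> 0 \<Longrightarrow> sum \<beta> {..<k} \<le> N"
    and x: "f x = 0"
  shows "pairing x p q ^ N * (\<Sum>(g, \<beta>, \<gamma>, \<delta>)\<in>{(g, \<beta>, \<gamma>, \<delta>)\<in>I. sum \<beta> {..<k} = N}.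
    c (g, \<beta>, \<gamma>, \<delta>) * (monom_at k x (pad g) * monom_at k (\<lambda>i. x i ^ k) \<beta>) *
      (monom_at m p \<gamma> * monom_at m q \<delta>)) = 0"
proof -
  \<comment> \<open>The substituted relation with its denominators cleared by
    \<open>f z ^ (2 * N)\<close>. Written without division, it also makes sense where
    \<open>f z = 0\<close>.\<close>
  define H where "H z = (\<Sum>(g, \<beta>, \<gamma>, \<delta>)\<in>I. c (g, \<beta>, \<gamma>, \<delta>) * (monom_at k z (pad g) *
    monom_at k (vLu_G z p q) \<beta> * f z ^ (2 * (N - sum \<beta> {..<k}))) * (monom_at m p \<gamma> * monom_at m q \<delta>))" for z
  have H0: "H z = 0" if "f z \<noteq> 0" for z
  proof -
    define u where "u = (\<lambda>t. (\<Sum>w<m. G z t w * p w) / f z)"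
    define v where "v = (\<lambda>t. (\<Sum>r<m. q r * G z r t) / f z)"
    have vLu_uv: "vLu u v = (\<lambda>i. (1 / (f z)\<^sup>2) * vLu_G z p q i)"
      unfolding u_def v_def vLu_G_def by (rule ext, rule vLu_scale)
    have "f z ^ (2 * N) * (c t * family t z u v) = (case t of (g, \<beta>, \<gamma>, \<delta>) \<Rightarrow>
      c (g, \<beta>, \<gamma>, \<delta>) * (monom_at k z (pad g) *
      monom_at k (vLu_G z p q) \<beta> * f z ^ (2 * (N - sum \<beta> {..<k}))) * (monom_at m p \<gamma> * monom_at m q \<delta>))"
      if "t \<in> I" for t
    proof -
      obtain g \<beta> \<gamma> \<delta> where t: "t = (g, \<beta>, \<gamma>, \<delta>)" by (cases t)
      show ?thesis
      proof (cases "c t = 0")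
        case False
        then have le: "sum \<beta> {..<k} \<le> N" using N that t by blast
        have fz: "f z ^ (2 * N) = f z ^ (2 * (N - sum \<beta> {..<k})) * ((f z)\<^sup>2) ^ sum \<beta> {..<k}"
          using le by (simp add: power_mult [symmetric] power_add [symmetric] algebra_simps)
        have "monom_at m (Au z u) \<gamma> = monom_at m p \<gamma>" "monom_at m (vA z v) \<delta> = monom_at m q \<delta>"
          unfolding u_def v_def using \<open>f z \<noteq> 0\<close>
          by (auto intro!: monom_at_cong Au_resolvent vA_resolvent)
        then show ?thesis
          unfolding t family_def prod.case vLu_uv monom_at_scale fz using \<open>f z \<noteq> 0\<close>
          by (simp add: power_one_over)
      qed (simp add: t)
    qed
    then have "H z = f z ^ (2 * N) * (\<Sum>t\<in>I. c t * family t z u v)"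
      unfolding H_def sum_distrib_left by (intro sum.cong) auto
    then show ?thesis using rel by simp
  qed
  \<comment> \<open>The point \<open>x\<close> is approached along the ray from the origin, on which
    \<open>f\<close> is nonzero for \<open>\<tau>\<close> strictly between 0 and 1; continuity
    carries \<open>H = 0\<close> over to \<open>x\<close>.\<close>
  let ?z = "\<lambda>\<tau>::real. \<lambda>i. of_real \<tau> * x i"
  have f_z: "f (?z \<tau>) = 1 - of_real \<tau> ^ Suc k" for \<tau>
  proof -
    have "f (?z \<tau>) = 1 + of_real \<tau> ^ Suc k * (f x - 1)"
      unfolding f_def by (simp add: power_mult_distrib sum_distrib_left ac_simps)
    then show ?thesis using x by simp
  qed
  have cont_y: "isCont (\<lambda>\<tau>. vLu_G (?z \<tau>) p q i) 1" for i
    unfolding vLu_G_def vLu_def using G_cont by (intro continuous_intros) auto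
  have "isCont (\<lambda>\<tau>. H (?z \<tau>)) 1"
    unfolding H_def case_prod_unfold f_z
    by (intro continuous_intros isCont_monom_at cont_y)
  then have "((\<lambda>\<tau>. H (?z \<tau>)) \<longlongrightarrow> H (?z 1)) (at_left 1)"
    unfolding isCont_def by (rule tendsto_within_subset) simp
  moreover have "eventually (\<lambda>\<tau>. H (?z \<tau>) = 0) (at_left 1)"
  proof -
    have "eventually (\<lambda>\<tau>::real. \<tau> \<in> {0<..<1}) (at_left 1)"
      by (rule eventually_at_left_real) simp
    then show ?thesis
    proof eventually_elim
      case (elim \<tau>)
      have "\<tau> ^ Suc k < 1" using elim by (intro power_Suc_less_one) auto
      then have "complex_of_real (\<tau> ^ Suc k) \<noteq> 1" by (metis of_real_eq_1_iff less_irrefl)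
      then have "f (?z \<tau>) \<noteq> 0" unfolding f_z by (simp del: power_Suc)
      then show ?case by (rule H0)
    qed
  qed
  ultimately have "((\<lambda>\<tau>::real. 0) \<longlongrightarrow> H (?z 1)) (at_left 1)"
    by (rule Lim_transform_eventually)
  then have Hx: "H x = 0" by (simp add: tendsto_const_iff)
  let ?J = "{(g, \<beta>, \<gamma>, \<delta>)\<in>I. sum \<beta> {..<k} = N}"
  let ?h = "\<lambda>(g, \<beta>, \<gamma>, \<delta>). c (g, \<beta>, \<gamma>, \<delta>) * (monom_at k x (pad g) * monom_at k (\<lambda>i. x i ^ k) \<beta>) *
      (monom_at m p \<gamma> * monom_at m q \<delta>)"
  have mono: "monom_at k (vLu_G x p q) \<beta> = (of_nat (Suc k) * pairing x p q) ^ sum \<beta> {..<k} *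
      monom_at k (\<lambda>i. x i ^ k) \<beta>" for \<beta>
    unfolding monom_at_scale[symmetric] using x by (intro monom_at_cong vLu_G_on_hypersurface)
  have "H x = (\<Sum>t\<in>I. if t \<in> ?J then (of_nat (Suc k) * pairing x p q) ^ N * ?h t else 0)"
    unfolding H_def
  proof (intro sum.cong refl)
    fix t assume "t \<in> I"
    obtain g \<beta> \<gamma> \<delta> where t: "t = (g, \<beta>, \<gamma>, \<delta>)" by (cases t)
    \<comment> \<open>Below degree \<open>N\<close> a positive power of \<open>f x = 0\<close>
      remains; above it the coefficient is zero.\<close>
    consider "sum \<beta> {..<k} = N" | "sum \<beta> {..<k} < N" | "c t = 0"
      using N \<open>t \<in> I\<close> unfolding t by (metis linorder_neqE_nat not_le)
    then show "(case t of (g, \<beta>, \<gamma>, \<delta>) \<Rightarrow> c (g, \<beta>, \<gamma>, \<delta>) * (monom_at k x (pad g) *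
        monom_at k (vLu_G x p q) \<beta> * f x ^ (2 * (N - sum \<beta> {..<k}))) * (monom_at m p \<gamma> * monom_at m q \<delta>)) =
      (if t \<in> ?J then (of_nat (Suc k) * pairing x p q) ^ N * ?h t else 0)"
      using \<open>t \<in> I\<close> by cases (simp_all add: t mono x)
  qed
  also have "\<dots> = (\<Sum>t\<in>?J. (of_nat (Suc k) * pairing x p q) ^ N * ?h t)"
    using fin by (intro sum.mono_neutral_cong_right) auto
  also have "\<dots> = of_nat (Suc k) ^ N * (pairing x p q ^ N * (\<Sum>t\<in>?J. ?h t))"
    by (simp add: sum_distrib_left power_mult_distrib mult.assoc del: of_nat_Suc)
  finally have "of_nat (Suc k) ^ N * (pairing x p q ^ N * (\<Sum>t\<in>?J. ?h t)) = 0"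
    using Hx by simp
  then show ?thesis by (simp del: of_nat_Suc)
qed

section \<open>Independence of the leading terms\<close>

definition slice :: "nat \<Rightarrow> nat \<Rightarrow> ((nat \<Rightarrow> nat) \<times> (nat \<Rightarrow> nat)) set" where
  "slice K N = {(g, \<beta>) \<in> boxes \<times> exponents k K. sum \<beta> {..<k} = N}"

lemma finite_slice: "finite (slice K N)"
  by (rule finite_subset[of _ "boxes \<times> exponents k K"])
    (auto simp: slice_def boxes_def card_exponents intro: finite_PiE)

text \<open>The polar relation holds for all \<open>p\<close> and \<open>q\<close>. As a polynomial
  in them, \<open>pairing\<close> is nonzero because \<open>G x\<close> is, so every coefficient of
  the other factor must vanish.\<close>

lemma leading_coefficient:
  assumes rel: "\<And>x u v. (\<Sum>t\<in>index K P. c t * family t x u v) = 0"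
    and N: "\<And>g \<beta> \<gamma> \<delta>. (g, \<beta>, \<gamma>, \<delta>) \<in> index K P \<Longrightarrow> c (g, \<beta>, \<gamma>, \<delta>) \<noteq> 0 \<Longrightarrow> sum \<beta> {..<k} \<le> N"
    and x: "f x = 0" and mem: "\<gamma>0 \<in> exponents m P" "\<delta>0 \<in> exponents m P"
  shows "(\<Sum>(g, \<beta>)\<in>slice K N. c (g, \<beta>, \<gamma>0, \<delta>0) *
    (monom_at k x (pad g) * monom_at k (\<lambda>i. x i ^ k) \<beta>)) = 0"
proof -
  define C where "C = (\<lambda>(\<gamma>, \<delta>). \<Sum>(g, \<beta>)\<in>slice K N. c (g, \<beta>, \<gamma>, \<delta>) *
    (monom_at k x (pad g) * monom_at k (\<lambda>i. x i ^ k) \<beta>))"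
  let ?E = "exponents m P \<times> exponents m P"
  let ?M = "{..<m} \<times> {..<m}"
  have pole: "pairing x p q ^ N * (\<Sum>(\<gamma>, \<delta>)\<in>?E. C (\<gamma>, \<delta>) * (monom_at m p \<gamma> * monom_at m q \<delta>)) = 0" for p q
  proof -
    have "(\<Sum>(\<gamma>, \<delta>)\<in>?E. C (\<gamma>, \<delta>) * (monom_at m p \<gamma> * monom_at m q \<delta>)) =
      (\<Sum>e\<in>?E. \<Sum>s\<in>slice K N. c (fst s, snd s, fst e, snd e) *
        (monom_at k x (pad (fst s)) * monom_at k (\<lambda>i. x i ^ k) (snd s)) *
          (monom_at m p (fst e) * monom_at m q (snd e)))"
      unfolding C_def by (simp add: case_prod_unfold sum_distrib_right)
    also have "\<dots> = (\<Sum>(e, s)\<in>?E \<times> slice K N. c (fst s, snd s, fst e, snd e) *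
        (monom_at k x (pad (fst s)) * monom_at k (\<lambda>i. x i ^ k) (snd s)) *
          (monom_at m p (fst e) * monom_at m q (snd e)))"
      by (rule sum.cartesian_product)
    also have "\<dots> = (\<Sum>(g, \<beta>, \<gamma>, \<delta>)\<in>{(g, \<beta>, \<gamma>, \<delta>)\<in>index K P. sum \<beta> {..<k} = N}.
        c (g, \<beta>, \<gamma>, \<delta>) * (monom_at k x (pad g) * monom_at k (\<lambda>i. x i ^ k) \<beta>) *
          (monom_at m p \<gamma> * monom_at m q \<delta>))"
      by (rule sum.reindex_bij_witness[where j = "\<lambda>((\<gamma>, \<delta>), (g, \<beta>)). (g, \<beta>, \<gamma>, \<delta>)"
            and i = "\<lambda>(g, \<beta>, \<gamma>, \<delta>). ((\<gamma>, \<delta>), (g, \<beta>))"])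
        (auto simp: index_def slice_def)
    finally show ?thesis using leading_pole[where c = c and p = p and q = q, OF rel card_index(1) N x] by simp
  qed
  have "C (\<gamma>0, \<delta>0) = 0"
  proof (rule ccontr)
    assume C0: "C (\<gamma>0, \<delta>0) \<noteq> 0"
    obtain r0 w0 where rw: "r0 < m" "w0 < m" "G x r0 w0 \<noteq> 0" using G_nonzero[OF x] by blast
    \<comment> \<open>A single point \<open>z\<close> holds \<open>p\<close> in its first
      \<open>m\<close> coordinates and \<open>q\<close> in the next \<open>m\<close>; neither factor
      vanishes there.\<close>
    have "\<exists>z. (\<Sum>s\<in>?E. C s * monom_at (m + m) z (case s of (\<gamma>, \<delta>) \<Rightarrow> join m \<gamma> \<delta>)) \<noteq> 0 \<and>
      (\<Sum>t\<in>?M. (case t of (r, w) \<Rightarrow> G x r w) *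
        monom_at (m + m) z (case t of (r, w) \<Rightarrow> join m (unit_exp w) (unit_exp r))) \<noteq> 0"
    proof (rule common_nonroot[of _ "(\<gamma>0, \<delta>0)" _ _ _ _ "(r0, w0)"])
      fix s assume "s \<in> ?E" "s \<noteq> (\<gamma>0, \<delta>0)"
      then show "\<exists>i<m + m. (case s of (\<gamma>, \<delta>) \<Rightarrow> join m \<gamma> \<delta>) i \<noteq>
          (case (\<gamma>0, \<delta>0) of (\<gamma>, \<delta>) \<Rightarrow> join m \<gamma> \<delta>) i"
        using mem by (cases s) (auto intro!: join_distinct simp: exponents_def)
    next
      fix t assume "t \<in> ?M" "t \<noteq> (r0, w0)"
      moreover have "unit_exp i \<noteq> unit_exp j" if "i \<noteq> j" for i j using that by (auto simp: fun_eq_iff)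
      ultimately show "\<exists>i<m + m. (case t of (r, w) \<Rightarrow> join m (unit_exp w) (unit_exp r)) i \<noteq>
          (case (r0, w0) of (r, w) \<Rightarrow> join m (unit_exp w) (unit_exp r)) i"
        using rw by (cases t) (auto intro!: join_distinct)
    qed (use mem C0 rw in \<open>auto simp: card_exponents\<close>)
    then obtain z where z: "(\<Sum>(\<gamma>, \<delta>)\<in>?E. C (\<gamma>, \<delta>) * monom_at (m + m) z (join m \<gamma> \<delta>)) \<noteq> 0"
      "(\<Sum>(r, w)\<in>?M. G x r w * monom_at (m + m) z (join m (unit_exp w) (unit_exp r))) \<noteq> 0"
      by (auto simp: case_prod_unfold)
    define q where "q i = z (m + i)" for i
    have "(\<Sum>(r, w)\<in>?M. G x r w * monom_at (m + m) z (join m (unit_exp w) (unit_exp r))) = pairing x z q"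
      unfolding pairing_def sum.cartesian_product
      by (intro sum.cong) (auto simp: monom_at_join monom_at_unit q_def)
    moreover have "(\<Sum>(\<gamma>, \<delta>)\<in>?E. C (\<gamma>, \<delta>) * monom_at (m + m) z (join m \<gamma> \<delta>)) =
        (\<Sum>(\<gamma>, \<delta>)\<in>?E. C (\<gamma>, \<delta>) * (monom_at m z \<gamma> * monom_at m q \<delta>))"
      unfolding monom_at_join q_def ..
    ultimately show False using pole[of z q] z by auto
  qed
  then show ?thesis by (simp add: C_def)
qed

text \<open>Below \<open>k - 1\<close>, division by \<open>k\<close> splits the exponent into the
  remainder \<open>g i\<close> and the quotient \<open>\<beta> i\<close>. Then \<open>g\<close>
  fixes \<open>pad g (k - 1)\<close>, which gives the last entry of \<open>\<beta>\<close>.\<close>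

lemma slice_distinct:
  assumes s: "(g, \<beta>) \<in> slice K N" "(g', \<beta>') \<in> slice K N" "(g, \<beta>) \<noteq> (g', \<beta>')"
  shows "\<exists>i<k. pad g i + k * \<beta> i \<noteq> pad g' i + k * \<beta>' i"
proof (rule ccontr)
  assume "\<not> ?thesis"
  then have eq: "pad g i + k * \<beta> i = pad g' i + k * \<beta>' i" if "i < k" for i using that by blast
  have g: "g \<in> boxes" "g' \<in> boxes" using s by (auto simp: slice_def)
  have low: "g i = g' i \<and> \<beta> i = \<beta>' i" if i: "i < k - 1" for i
  proof -
    have lt: "g i < k" "g' i < k" using g i unfolding boxes_def by (auto dest!: PiE_mem)
    have e: "g i + k * \<beta> i = g' i + k * \<beta>' i" using eq[of i] i by (simp add: pad_def)
    from arg_cong[OF e, of "\<lambda>n. n mod k"] lt have "g i = g' i" by simp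
    with e k_pos show ?thesis by simp
  qed
  have "g = g'"
  proof
    fix i show "g i = g' i"
      using low[of i] g unfolding boxes_def by (cases "i < k - 1") (auto simp: PiE_def extensional_def)
  qed
  moreover have "\<beta> = \<beta>'"
  proof
    fix i
    have last: "\<beta> (k - 1) = \<beta>' (k - 1)"
      using eq[of "k - 1"] k_pos \<open>g = g'\<close> by simp
    show "\<beta> i = \<beta>' i"
    proof (cases "i < k")
      case True
      then show ?thesis using last low[of i] by (cases "i = k - 1") auto
    next
      case False
      then show ?thesis using s by (auto simp: slice_def exponents_def)
    qed
  qed
  ultimately show False using s(3) by simp
qed

lemma monom_at_pad_power:
  "monom_at n x (pad g) * monom_at n (\<lambda>i. x i ^ k) \<beta> = monom_at n x (\<lambda>i. pad g i + k * \<beta> i)"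
  by (simp add: monom_at_def power_add power_mult prod.distrib)

text \<open>The points \<open>z / w\<close> with \<open>w ^ Suc k = - (\<Sum>i<k. z i ^ Suc k)\<close> lie on the hypersurface, so a
  homogeneous relation holding there holds at every \<open>z\<close>.\<close>

lemma slice_independent:
  assumes van: "\<And>x. f x = 0 \<Longrightarrow> (\<Sum>(g, \<beta>)\<in>slice K N. c (g, \<beta>) *
    (monom_at k x (pad g) * monom_at k (\<lambda>i. x i ^ k) \<beta>)) = 0"
    and s0: "s0 \<in> slice K N"
  shows "c s0 = 0"
proof (rule ccontr)
  assume c0: "c s0 \<noteq> 0"
  let ?ex = "\<lambda>s i. pad (fst s) i + k * snd s i"
  \<comment> \<open>Exponent vectors of the powers \<open>z j ^ Suc k\<close>, whose sum must be
    nonzero for \<open>w\<close> to be invertible.\<close>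
  let ?ey = "\<lambda>j i. Suc k * unit_exp j i"
  have "\<exists>z. (\<Sum>s\<in>slice K N. c s * monom_at k z (?ex s)) \<noteq> 0 \<and>
      (\<Sum>j\<in>{..<k}. 1 * monom_at k z (?ey j)) \<noteq> (0 :: complex)"
  proof (rule common_nonroot[of _ s0 _ _ _ _ 0])
    fix s assume "s \<in> slice K N" "s \<noteq> s0"
    then show "\<exists>i<k. ?ex s i \<noteq> ?ex s0 i"
      using slice_distinct[of "fst s" "snd s" K N "fst s0" "snd s0"] s0 by simp
  next
    fix j assume "j \<in> {..<k}" "j \<noteq> 0"
    then show "\<exists>i<k. ?ey j i \<noteq> ?ey 0 i" by (intro exI[of _ j]) auto
  qed (use s0 c0 k_pos finite_slice in auto)
  then obtain z where z: "(\<Sum>s\<in>slice K N. c s * monom_at k z (?ex s)) \<noteq> 0"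
    "(\<Sum>j\<in>{..<k}. monom_at k z (?ey j)) \<noteq> (0 :: complex)" by auto
  have "monom_at k z (?ey j) = z j ^ Suc k" if "j < k" for j
  proof -
    have "monom_at k z (?ey j) = monom_at k (\<lambda>i. z i ^ Suc k) (unit_exp j)"
      by (simp add: monom_at_def power_mult [symmetric] del: power_Suc)
    then show ?thesis using that by (simp only: monom_at_unit)
  qed
  with z(2) have S: "(\<Sum>i<k. z i ^ Suc k) \<noteq> 0" by simp
  obtain w where w: "w ^ Suc k = - (\<Sum>i<k. z i ^ Suc k)"
    using complex_nth_root_exists[of "Suc k"] by blast
  with S have w0: "w \<noteq> 0" by auto
  \<comment> \<open>The common degree of all monomials in the slice, by padding and by the choice of
    \<open>N\<close>; hence the scaling by \<open>1 / w\<close> factors out.\<close>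
  define D where "D = (k - 1) * (k - 1) + k * N"
  have "f (\<lambda>i. (1 / w) * z i) = 1 + (1 / w ^ Suc k) * (\<Sum>i<k. z i ^ Suc k)"
    unfolding f_def by (simp add: power_divide sum_divide_distrib)
  also have "\<dots> = 0" using S by (simp add: w del: power_Suc)
  finally have "(\<Sum>(g, \<beta>)\<in>slice K N. c (g, \<beta>) *
    (monom_at k (\<lambda>i. (1 / w) * z i) (pad g) * monom_at k (\<lambda>i. ((1 / w) * z i) ^ k) \<beta>)) = 0"
    by (rule van)
  also have "(\<Sum>(g, \<beta>)\<in>slice K N. c (g, \<beta>) *
    (monom_at k (\<lambda>i. (1 / w) * z i) (pad g) * monom_at k (\<lambda>i. ((1 / w) * z i) ^ k) \<beta>)) =
    (\<Sum>s\<in>slice K N. (1 / w) ^ D * (c s * monom_at k z (?ex s)))"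
  proof (intro sum.cong refl)
    fix s assume "s \<in> slice K N"
    then have "(\<Sum>i<k. ?ex s i) = D"
      by (auto simp: slice_def sum.distrib sum_pad D_def sum_distrib_left [symmetric])
    then show "(case s of (g, \<beta>) \<Rightarrow> c (g, \<beta>) *
      (monom_at k (\<lambda>i. (1 / w) * z i) (pad g) * monom_at k (\<lambda>i. ((1 / w) * z i) ^ k) \<beta>)) =
      (1 / w) ^ D * (c s * monom_at k z (?ex s))"
      unfolding case_prod_unfold unfolding monom_at_pad_power unfolding monom_at_scale by simp
  qed
  also have "\<dots> = (1 / w) ^ D * (\<Sum>s\<in>slice K N. c s * monom_at k z (?ex s))"
    by (simp add: sum_distrib_left)
  finally show False using w0 z(1) by simp
qed

text \<open>A failure would give a relation. Its terms of highest degree in the \<open>vLu\<close>,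
  at fixed exponents of \<open>Au\<close> and \<open>vA\<close>, would relate distinct monomials in
  \<open>x\<close> on the hypersurface, which \<open>slice_independent\<close> excludes.\<close>

lemma counting_bound:
  "k ^ (k - 1) * (((K + k) choose k) * (((P + m) choose m) * ((P + m) choose m))) \<le>
   (((k - 1) * (k - 1) + 2 * P + k) choose k) * (((K + P + m) choose m) * ((K + P + m) choose m))"
proof (rule ccontr)
  assume "\<not> ?thesis"
  then obtain c where c: "\<exists>t\<in>index K P. c t \<noteq> 0"
    and rel: "\<And>x u v. (\<Sum>t\<in>index K P. c t * family t x u v) = 0"
    using family_dependent[of P K] by (auto simp: not_le)
  define D where "D = (\<lambda>(g, \<beta>, \<gamma>, \<delta>). sum \<beta> {..<k}) ` {t \<in> index K P. c t \<noteq> 0}"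
  have D: "finite D" "D \<noteq> {}" using c card_index(1)[of K P] by (auto simp: D_def)
  have N: "sum \<beta> {..<k} \<le> Max D" if "(g, \<beta>, \<gamma>, \<delta>) \<in> index K P" "c (g, \<beta>, \<gamma>, \<delta>) \<noteq> 0" for g \<beta> \<gamma> \<delta>
    using D(1) that by (intro Max_ge) (force simp: D_def)+
  from Max_in[OF D] obtain g \<beta> \<gamma> \<delta> where t: "(g, \<beta>, \<gamma>, \<delta>) \<in> index K P" "c (g, \<beta>, \<gamma>, \<delta>) \<noteq> 0"
    "sum \<beta> {..<k} = Max D"
    unfolding D_def by auto
  have van: "(\<Sum>(g, \<beta>)\<in>slice K (Max D). c (g, \<beta>, \<gamma>, \<delta>) *
      (monom_at k x (pad g) * monom_at k (\<lambda>i. x i ^ k) \<beta>)) = 0" if "f x = 0" for x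
    using t(1) by (intro leading_coefficient[where P = P] rel N that) (auto simp: index_def)
  have "(case (g, \<beta>) of (g, \<beta>) \<Rightarrow> c (g, \<beta>, \<gamma>, \<delta>)) = 0"
    by (rule slice_independent[where K = K and N = "Max D"])
      (use van t in \<open>auto simp: slice_def index_def\<close>)
  with t(2) show False by simp
qed

subsection \<open>The bound on the size\<close>

text \<open>If \<open>m \<le> N\<close>, the counting bound reduces to
  \<open>k ^ (k - 1) \<le> (3 * (4 * N + 1) / k) ^ k\<close>. By the first assumption the right side
  is at most \<open>(k / 2) ^ k\<close>, contradicting \<open>k < 2 ^ k\<close>.\<close>

lemma size_bound:
  assumes N: "24 * N + 6 \<le> k\<^sup>2" "k \<le> 4 * N"
  shows "N < m"
proof (rule ccontr)
  assume "\<not> N < m"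
  then have mN: "m \<le> N" by simp
  have N0: "0 < N" using N(2) k_pos by simp
  \<comment> \<open>The scale \<open>\<tau>\<close> is large enough to absorb the degree of the
    padding. The ratio of \<open>K\<close> to \<open>P\<close>, namely \<open>k\<close> to
    \<open>2 * N\<close>, keeps the combined growth of the \<open>u\<close> and \<open>v\<close>
    binomials within \<open>exp 1 ^ k\<close>.\<close>
  define \<tau> where "\<tau> = (k - 1) * (k - 1) + 1"
  define K where "K = k * \<tau>"
  define P where "P = 2 * N * \<tau>"
  have \<tau>0: "0 < \<tau>" by (simp add: \<tau>_def)
  have K0: "0 < K" and P0: "0 < P" using k_pos N0 by (auto simp: K_def P_def \<tau>_def)
  let ?X = "(k - 1) * (k - 1) + 2 * P"
  have X_le: "?X \<le> (4 * N + 1) * \<tau>" 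
  proof -
    have "(k - 1) * (k - 1) \<le> \<tau>" by (simp add: \<tau>_def)
    then show ?thesis unfolding P_def by (simp add: distrib_right)
  qed
  have K_le: "K \<le> ?X"
  proof -
    have "K \<le> 4 * N * \<tau>" unfolding K_def using N(2) by (rule mult_right_mono) simp
    then show ?thesis unfolding P_def by simp
  qed
  let ?a = "real ((K + k) choose k)" and ?b = "real ((P + m) choose m)"
  have pos: "?a > 0" "?b > 0" by simp_all
  have "real ?X / real K \<le> real ((4 * N + 1) * \<tau>) / real K"
    using X_le by (intro divide_right_mono) (simp_all only: of_nat_le_iff of_nat_0_le_iff)
  also have "\<dots> = real (4 * N + 1) / real k"
    using \<tau>0 unfolding K_def of_nat_mult by simp
  finally have X: "real ?X / real K \<le> real (4 * N + 1) / real k" .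
  have "real ((?X + k) choose k) \<le> (real ?X / real K) ^ k * ?a"
    by (rule choose_ratio_bound[OF K0 K_le])
  also have "\<dots> \<le> (real (4 * N + 1) / real k) ^ k * ?a"
    using X by (intro mult_right_mono power_mono) auto
  finally have bound_x: "real ((?X + k) choose k) \<le> (real (4 * N + 1) / real k) ^ k * ?a" .
  have ratio: "real (K + P) / real P = 1 + real k / real (2 * N)"
    using \<tau>0 N0 unfolding K_def P_def by (simp add: field_simps)
  have "((1 + real k / real (2 * N)) ^ m)\<^sup>2 \<le> (1 + real k / real (2 * N)) ^ (2 * N)"
    unfolding power_mult [symmetric] using mN by (intro power_increasing) auto
  also have "\<dots> \<le> exp (real k / real (2 * N)) ^ (2 * N)"
    by (intro power_mono exp_ge_add_one_self) auto
  also have "\<dots> = exp 1 ^ k"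
    using N0 by (simp add: exp_of_nat_mult [symmetric])
  also have "\<dots> \<le> 3 ^ k"
    using exp_le by (intro power_mono) auto
  finally have e: "((1 + real k / real (2 * N)) ^ m)\<^sup>2 \<le> 3 ^ k" .
  have "real ((K + P + m) choose m) \<le> (1 + real k / real (2 * N)) ^ m * ?b"
    using choose_ratio_bound[OF P0, of "K + P" m] unfolding ratio by simp
  then have "(real ((K + P + m) choose m))\<^sup>2 \<le> ((1 + real k / real (2 * N)) ^ m * ?b)\<^sup>2"
    by (intro power_mono) auto
  also have "\<dots> \<le> 3 ^ k * ?b\<^sup>2"
    using e unfolding power_mult_distrib by (intro mult_right_mono) auto
  finally have bound_u: "(real ((K + P + m) choose m))\<^sup>2 \<le> 3 ^ k * ?b\<^sup>2" .
  have "real (k ^ (k - 1) * (((K + k) choose k) * (((P + m) choose m) * ((P + m) choose m)))) \<le>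
    real (((?X + k) choose k) * (((K + P + m) choose m) * ((K + P + m) choose m)))"
    using counting_bound[of K P] by (simp only: of_nat_le_iff)
  then have "real k ^ (k - 1) * (?a * ?b\<^sup>2) \<le> real ((?X + k) choose k) * (real ((K + P + m) choose m))\<^sup>2"
    unfolding of_nat_mult of_nat_power power2_eq_square .
  also have "\<dots> \<le> ((real (4 * N + 1) / real k) ^ k * ?a) * (3 ^ k * ?b\<^sup>2)"
    using bound_x bound_u by (intro mult_mono) auto
  also have "\<dots> = (3 * (real (4 * N + 1) / real k)) ^ k * (?a * ?b\<^sup>2)"
    by (simp only: power_mult_distrib mult_ac)
  finally have "real k ^ (k - 1) \<le> (3 * (real (4 * N + 1) / real k)) ^ k"
    using pos by (subst (asm) mult_le_cancel_right_pos) auto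
  also have "\<dots> \<le> (real k / 2) ^ k"
  proof (intro power_mono)
    have "real (24 * N + 6) \<le> real (k\<^sup>2)" using N(1) by (simp only: of_nat_le_iff)
    then show "3 * (real (4 * N + 1) / real k) \<le> real k / 2"
      using k_pos by (simp add: field_simps power2_eq_square)
  qed simp
  also have "\<dots> = real k ^ (k - 1) * (real k / 2 ^ k)"
    using k_pos by (cases k) (simp_all add: power_divide)
  finally have "1 \<le> real k / 2 ^ k"
    using k_pos by (subst (asm) mult_le_cancel_left1) auto
  then have "2 ^ k \<le> real k" by (simp add: field_simps)
  moreover have "real k < 2 ^ k" by (rule of_nat_less_two_power)
  ultimately show False by linarith
qed

end

text \<open>Dehomogenisation: the last indeterminate becomes 1.\<close>

lemma fermat_determinant_of_affine_matrix:
  assumes k: "k > 0"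
    and det: "Determinant.det (affine_matrix (Suc k) m M) = (\<Sum>i = 1..Suc k. indet i ^ Suc k)"
  shows "fermat_determinant k m (\<lambda>r s. M 0 $$ (r, s) + M (Suc k) $$ (r, s)) (\<lambda>i r s. M (Suc i) $$ (r, s))"
proof
  fix x :: "nat \<Rightarrow> complex"
  \<comment> \<open>Indeterminates are numbered from 1 but coordinates of \<open>x\<close> from 0,
    hence the shift.\<close>
  define \<xi> where "\<xi> i = (if i = Suc k then 1 else x (i - 1))" for i
  interpret comm_ring_hom "eval_poly \<xi>" by (rule comm_ring_hom_eval_poly)
  have sum: "(\<Sum>i = Suc 0..Suc k. g i) = (\<Sum>i<k. g (Suc i)) + g (Suc k)" for g :: "nat \<Rightarrow> complex"
    by (simp only: One_nat_def sum.atLeast1_atMost_eq lessThan_Suc_atMost [symmetric] sum.lessThan_Suc)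
  have "map_mat (eval_poly \<xi>) (affine_matrix (Suc k) m M) =
    mat m m (\<lambda>(r, s). M 0 $$ (r, s) + M (Suc k) $$ (r, s) + (\<Sum>i<k. x i * M (Suc i) $$ (r, s)))"
    by (rule eq_matI)
      (simp_all add: affine_matrix_def hom_distribs eval_poly_const eval_poly_indet sum \<xi>_def del: sum.cl_ivl_Suc)
  moreover have "eval_poly \<xi> (\<Sum>i = 1..Suc k. indet i ^ Suc k) = 1 + (\<Sum>i<k. x i ^ Suc k)"
    by (simp add: hom_distribs eval_poly_indet sum \<xi>_def del: sum.cl_ivl_Suc power_Suc)
  ultimately show "Determinant.det (mat m m (\<lambda>(r, s). M 0 $$ (r, s) + M (Suc k) $$ (r, s) +
      (\<Sum>i<k. x i * M (Suc i) $$ (r, s)))) = 1 + (\<Sum>i<k. x i ^ Suc k)"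
    using hom_det[of "affine_matrix (Suc k) m M"] det by simp
qed (rule k)

theorem theorem1p1:
  shows "\<exists>(c::real) (n\<^sub>0::nat). c > 0 \<and>
    (\<forall>(n::nat) \<ge> n\<^sub>0. \<forall>(m::nat) (M :: nat \<Rightarrow> complex mat).
      (\<forall>i\<in>{0..n}. M i \<in> carrier_mat m m) \<longrightarrow>
      Determinant.det (affine_matrix n m M) = (\<Sum>i = 1..n. indet i ^ n) \<longrightarrow>
      real m \<ge> c * (real n)^2)"
proof (rule exI[of _ "1 / 192"], rule exI[of _ 201], intro conjI allI impI)
  fix n m :: nat and M :: "nat \<Rightarrow> complex mat"
  assume n: "n \<ge> 201" and det: "Determinant.det (affine_matrix n m M) = (\<Sum>i = 1..n. indet i ^ n)"
  obtain k where k: "n = Suc k" using n by (cases n) auto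
  have k200: "k \<ge> 200" using n k by simp
  interpret fermat_determinant k m "\<lambda>r s. M 0 $$ (r, s) + M (Suc k) $$ (r, s)" "\<lambda>i r s. M (Suc i) $$ (r, s)"
    using k200 det unfolding k by (intro fermat_determinant_of_affine_matrix) auto
  \<comment> \<open>The largest \<open>N\<close> allowed by the first hypothesis of
    \<open>size_bound\<close>; rounding costs less than 24, hence the 30 below.\<close>
  define N where "N = (k\<^sup>2 - 6) div 24"
  have kk: "200 * k \<le> k\<^sup>2" using k200 by (simp add: power2_eq_square)
  have N: "24 * N + 6 \<le> k\<^sup>2" "k\<^sup>2 \<le> 24 * N + 30"
    using kk k200 unfolding N_def by linarith+
  have "N < m" using N kk k200 by (intro size_bound) linarith+
  then have "real (k\<^sup>2) \<le> 24 * real m + 30" using N(2) by linarith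
  moreover have "real n ^ 2 \<le> 4 * real (k\<^sup>2) - 240"
  proof -
    have "n\<^sup>2 = k\<^sup>2 + 2 * k + 1" unfolding k by (simp add: power2_eq_square)
    then have "n\<^sup>2 + 240 \<le> 4 * k\<^sup>2" using kk k200 by linarith
    then have "real (n\<^sup>2 + 240) \<le> real (4 * k\<^sup>2)" by (simp only: of_nat_le_iff)
    then show ?thesis by simp
  qed
  \<comment> \<open>Together these give \<open>n\<^sup>2 \<le> 96 * m - 120\<close>, so the constant
    1/192 leaves room to spare.\<close>
  ultimately show "1 / 192 * (real n)^2 \<le> real m" by linarith
qed simp

end
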